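(* Let $\Gamma$ be a Moore graph of diameter $2$ and valency $57$ (if one exists), let $L$ be its Laplacian matrix, and let $e_0$ denote the rank of $L$ over a field of characteristic $5$. Then either \[ \mathrm{Syl}_5(K(\Gamma))\cong(\mathbb{Z}/5\mathbb{Z})^{1520-e_0}\oplus(\mathbb{Z}/5^2\mathbb{Z})^{1732-e_0}\oplus(\mathbb{Z}/5^3\mathbb{Z})^{e_0-3} \] or \[ \mathrm{Syl}_5(K(\Gamma))\cong(\mathbb{Z}/5\mathbb{Z})^{1521-e_0}\oplus(\mathbb{Z}/5^2\mathbb{Z})^{1730-e_0}\oplus(\mathbb{Z}/5^3\mathbb{Z})^{e_0-2}. \]
   Context: A Moore graph of diameter $d$ and valency $k$ is a simple $k$-regular graph of diameter $d$ and girth $2d+1$. For a simple graph $\Gamma$ with adjacency matrix $A$ and diagonal degree matrix $D$, the Laplacian matrix is $L=D-A$, viewed as a homomorphism $\mathbb{Z}^{V(\Gamma)}\to\mathbb{Z}^{V(\Gamma)}$. The critical group $K(\Gamma)$ is the torsion subgroup of $\operatorname{coker} L=\mathbb{Z}^{V(\Gamma)}/\operatorname{im}(L)$, and $\mathrm{Syl}_5(K(\Gamma))$ denotes its Sylow $5$-subgroup. *)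

theory Defs
  imports
    "HOL-Analysis.Cartesian_Space"
    "HOL-Library.Extended_Nat"
    "HOL-Computational_Algebra.Primes"
    "HOL-Algebra.Product_Groups"
    "HOL-Algebra.Elementary_Groups"
    "HOL-Algebra.Multiplicative_Group"
    "HOL-Algebra.Sylow"
begin

definition simple_graph :: "('v \<Rightarrow> 'v \<Rightarrow> bool) \<Rightarrow> bool" where
  "simple_graph adj \<longleftrightarrow> symp adj \<and> irreflp adj"

definition graph_degree :: "('v \<Rightarrow> 'v \<Rightarrow> bool) \<Rightarrow> 'v \<Rightarrow> nat" where
  "graph_degree adj v = card {w. adj v w}"

definition regular_graph :: "nat \<Rightarrow> ('v \<Rightarrow> 'v \<Rightarrow> bool) \<Rightarrow> bool" where
  "regular_graph k adj \<longleftrightarrow> (\<forall>v. graph_degree adj v = k)"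

text \<open>The infimum over the lengths of all walks; it is \<open>\<infinity>\<close> for vertices in different components.\<close>

definition graph_dist :: "('v \<Rightarrow> 'v \<Rightarrow> bool) \<Rightarrow> 'v \<Rightarrow> 'v \<Rightarrow> enat" where
  "graph_dist adj u v = Inf {enat n | n. (adj ^^ n) u v}"

definition graph_diameter :: "('v \<Rightarrow> 'v \<Rightarrow> bool) \<Rightarrow> enat" where
  "graph_diameter adj = Sup {graph_dist adj u v | u v. True}"

definition is_cycle :: "('v \<Rightarrow> 'v \<Rightarrow> bool) \<Rightarrow> 'v list \<Rightarrow> bool" where
  "is_cycle adj xs \<longleftrightarrow>
     length xs \<ge> 3 \<and> distinct xs \<and> successively adj xs \<and> adj (last xs) (hd xs)"

definition girth :: "('v \<Rightarrow> 'v \<Rightarrow> bool) \<Rightarrow> enat" where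
  "girth adj = Inf {enat (length xs) | xs. is_cycle adj xs}"

definition moore_graph :: "nat \<Rightarrow> nat \<Rightarrow> ('v \<Rightarrow> 'v \<Rightarrow> bool) \<Rightarrow> bool" where
  "moore_graph d k adj \<longleftrightarrow>
     simple_graph adj \<and> regular_graph k adj \<and>
     graph_diameter adj = enat d \<and> girth adj = enat (2 * d + 1)"

definition adjacency_matrix :: "('v::finite \<Rightarrow> 'v \<Rightarrow> bool) \<Rightarrow> int ^ 'v ^ 'v" where
  "adjacency_matrix adj = (\<chi> i j. if adj i j then 1 else 0)"

definition degree_matrix :: "('v::finite \<Rightarrow> 'v \<Rightarrow> bool) \<Rightarrow> int ^ 'v ^ 'v" where
  "degree_matrix adj = (\<chi> i j. if i = j then int (graph_degree adj i) else 0)"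

definition laplacian :: "('v::finite \<Rightarrow> 'v \<Rightarrow> bool) \<Rightarrow> int ^ 'v ^ 'v" where
  "laplacian adj = degree_matrix adj - adjacency_matrix adj"

definition int_vec_group :: "(int ^ 'v) monoid" where
  "int_vec_group = \<lparr>carrier = UNIV, monoid.mult = (+), one = 0\<rparr>"

definition coker :: "int ^ 'v ^ 'v \<Rightarrow> (int ^ 'v::finite) set monoid" where
  "coker M = int_vec_group Mod range (\<lambda>x. M *v x)"

definition torsion_subgroup :: "('a, 'b) monoid_scheme \<Rightarrow> ('a, 'b) monoid_scheme" where
  "torsion_subgroup G =
     G\<lparr>carrier := {x \<in> carrier G. \<exists>n::nat. n > 0 \<and> x [^]\<^bsub>G\<^esub> n = \<one>\<^bsub>G\<^esub>}\<rparr>"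

definition critical_group :: "('v::finite \<Rightarrow> 'v \<Rightarrow> bool) \<Rightarrow> (int ^ 'v) set monoid" where
  "critical_group adj = torsion_subgroup (coker (laplacian adj))"

definition is_sylow :: "nat \<Rightarrow> ('a, 'b) monoid_scheme \<Rightarrow> 'a set \<Rightarrow> bool" where
  "is_sylow p G P \<longleftrightarrow> subgroup P G \<and> card P = p ^ multiplicity p (Coset.order G)"

lemma (in comm_group) ex1_sylow:
  assumes fin: "finite (carrier G)" and p: "prime p"
  shows "\<exists>!P. is_sylow p G P"
proof -
  define a where "a = multiplicity p (Coset.order G)"
  have pos: "Coset.order G > 0"
    using fin by (simp add: order_gt_0_iff_finite)
  have "Coset.order G = p ^ a * (Coset.order G div p ^ a)"
    by (simp add: a_def multiplicity_dvd)
  then have ex: "\<exists>P. is_sylow p G P"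
    unfolding is_sylow_def a_def[symmetric] using sylow_thm[OF p is_group _ fin] by blast
  have sub: "Q \<subseteq> P" if P: "is_sylow p G P" and Q: "is_sylow p G Q" for P Q
  proof -
    have sP: "subgroup P G" and sQ: "subgroup Q G"
      and cP: "card P = p ^ a" and cQ: "card Q = p ^ a"
      using P Q by (auto simp: is_sylow_def a_def)
    interpret N: normal P G
      using sP by (rule subgroup_imp_normal)
    interpret Q: group "G\<lparr>carrier := Q\<rparr>"
      using sQ by (rule subgroup_imp_group)
    interpret F: group "G Mod P"
      by (rule N.factorgroup_is_group)
    interpret h: group_hom G "G Mod P" "\<lambda>x. P #> x"
      by unfold_locales (rule N.r_coset_hom_Mod)
    define m where "m = Coset.order (G Mod P)"
    have om: "m * p ^ a = Coset.order G"
      using lagrange[OF sP] cP by (simp add: m_def Coset.order_def FactGroup_def)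
    have "\<not> p dvd m"
    proof
      assume "p dvd m"
      then have "p ^ Suc a dvd Coset.order G"
        unfolding om[symmetric] by (simp add: mult_dvd_mono)
      then show False
        using multiplicity_geI[of "Coset.order G" p "Suc a"] pos prime_gt_1_nat[OF p] by (auto simp: a_def[symmetric])
    qed
    then have cop: "coprime (p ^ a) m"
      using p by (simp add: prime_imp_coprime)
    show "Q \<subseteq> P"
    proof
      fix x assume x: "x \<in> Q"
      then have xG: "x \<in> carrier G"
        using sQ by (rule subgroup.mem_carrier[rotated])
      have "x [^] (p ^ a) = \<one>"
        using Q.pow_order_eq_1[of x] x by (simp add: Coset.order_def cQ flip: nat_pow_consistent)
      then have "(P #> x) [^]\<^bsub>G Mod P\<^esub> (p ^ a) = \<one>\<^bsub>G Mod P\<^esub>"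
        using h.hom_nat_pow[OF xG, of "p ^ a"] by simp
      then have "F.ord (P #> x) dvd p ^ a"
        using F.pow_eq_id h.hom_closed[OF xG] by blast
      moreover have "F.ord (P #> x) dvd m"
        unfolding m_def using F.ord_dvd_group_order h.hom_closed[OF xG] by blast
      ultimately have "F.ord (P #> x) = 1"
        using cop by (metis coprime_common_divisor_nat)
      then have "P #> x = \<one>\<^bsub>G Mod P\<^esub>"
        using F.ord_eq_1 h.hom_closed[OF xG] by blast
      then show "x \<in> P"
        using xG sP by (metis one_FactGroup coset_join1)
    qed
  qed
  show ?thesis using ex sub by (metis subset_antisym)
qed

text \<open>Meant for finite abelian groups, where the description is proper by \<open>ex1_sylow\<close>.\<close>

definition syl :: "nat \<Rightarrow> ('a, 'b) monoid_scheme \<Rightarrow> ('a, 'b) monoid_scheme" where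
  "syl p G = G\<lparr>carrier := (THE P. is_sylow p G P)\<rparr>"

definition cyclic_power :: "nat \<Rightarrow> nat \<Rightarrow> (nat \<Rightarrow> int) monoid" where
  "cyclic_power n m = product_group {..<m} (\<lambda>_. integer_mod_group n)"

end

theory Submission
  imports
    Defs
    "HOL-Analysis.Determinants"
    "HOL-Analysis.Weierstrass_Theorems"
begin

text \<open>
  Counting common neighbours gives \<open>L\<^sup>2 = 115 L - 3250 I + J\<close> and \<open>L J = 0\<close>, so \<open>L\<close> has eigenvalues
  \<open>0, 50, 65\<close>, the critical group \<open>K\<close> is the group of sum-zero vectors modulo the image of \<open>L\<close>, and
  \<open>3250 = 5\<^sup>3 \<sqdot> 26\<close> annihilates \<open>K\<close>. Hence the Sylow \<open>5\<close>-subgroup is the \<open>125\<close>-torsion, a sum of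
  \<open>e\<^sub>1, e\<^sub>2, e\<^sub>3\<close> copies of \<open>\<int>/5, \<int>/25, \<int>/125\<close>. For \<open>j = 1, 2, 3\<close> let \<open>M\<^sub>j\<close> (\<open>div_lattice j\<close>) be the lattice of all \<open>x\<close>
  with \<open>5\<^sup>j\<close> dividing \<open>L x\<close>; its reduction modulo \<open>5\<close> has dimension \<open>1 + \<Sum>\<^sub>i\<^sub>\<ge>\<^sub>j e\<^sub>i\<close>.

  The reduction of \<open>M\<^sub>1\<close> is the kernel of \<open>L\<close> modulo \<open>5\<close>, of dimension \<open>3250 - e\<^sub>0\<close>.

  The reduction of \<open>M\<^sub>2\<close> contains that of the \<open>50\<close>-eigenlattice, of dimension \<open>1729\<close>, and is orthogonal to
  that of the \<open>65\<close>-eigenlattice, of dimension \<open>1520\<close>, and to one further vector \<open>L e\<^sub>v\<close>; so its dimension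
  is \<open>1729\<close>.

  Since \<open>L (115 - L) = 3250\<close> on sum-zero vectors, the reduction of \<open>M\<^sub>3\<close> is the image of the sum-zero
  vectors under \<open>L\<close> modulo \<open>5\<close>. As \<open>L\<^sup>2 \<equiv> J\<close>, it is a hyperplane in the image of \<open>L\<close>, of dimension \<open>e\<^sub>0 - 1\<close>.

  Therefore \<open>e\<^sub>3 = e\<^sub>0 - 2\<close>, \<open>e\<^sub>2 = 1730 - e\<^sub>0\<close>, \<open>e\<^sub>1 = 1521 - e\<^sub>0\<close>: the second alternative always holds.
\<close>

section \<open>Abelian groups of exponent dividing the cube of a prime\<close>

lemma (in comm_group) comm_group_subgroup:
  "subgroup H G \<Longrightarrow> comm_group (G\<lparr>carrier := H\<rparr>)"
  by (intro group.group_comm_groupI subgroup_imp_group) (auto dest: subgroup.mem_carrier intro: m_comm)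

text \<open>A subgroup \<open>H\<close> that is maximal among those meeting the powers of
  \<open>z\<close> trivially is a complement. If the product \<open>Q\<close> of the two were
  proper, an element outside \<open>Q\<close> could be corrected by a power of \<open>z\<close> so
  that adjoining it to \<open>H\<close> contradicts maximality.\<close>

lemma (in comm_group) cyclic_complement:
  fixes p k :: nat
  assumes fin: "finite (carrier G)" and p: "prime p"
    and exp: "\<And>x. x \<in> carrier G \<Longrightarrow> x [^] (p ^ Suc k) = \<one>"
    and z: "z \<in> carrier G" and ordz: "ord z = p ^ Suc k"
  obtains H where "subgroup H G"
    and "\<And>i::int. z [^] i \<in> H \<Longrightarrow> z [^] i = \<one>"
    and "\<And>x. x \<in> carrier G \<Longrightarrow> \<exists>i::int. \<exists>h\<in>H. x = z [^] i \<otimes> h"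
proof -
  define S where "S = {H. subgroup H G \<and> (\<forall>i::int. z [^] i \<in> H \<longrightarrow> z [^] i = \<one>)}"
  have "S \<subseteq> Pow (carrier G)"
    unfolding S_def using subgroup.subset by blast
  then have "finite S"
    using fin by (simp add: finite_subset)
  moreover have "{\<one>} \<in> S"
    unfolding S_def by (simp add: triv_subgroup)
  ultimately obtain H where H: "H \<in> S" and Hmax: "\<And>H'. H' \<in> S \<Longrightarrow> H \<subseteq> H' \<Longrightarrow> H = H'"
    by (metis finite_has_maximal empty_iff)
  have sH: "subgroup H G" and Hz: "\<And>i::int. z [^] i \<in> H \<Longrightarrow> z [^] i = \<one>"
    using H by (auto simp: S_def)
  have Hc: "h \<in> carrier G" if "h \<in> H" for h
    using that sH by (rule subgroup.mem_carrier[rotated])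
  have prodI: "y [^] (i::int) \<otimes> h \<in> generate G {y} <#> H"
    and prodD: "\<And>x. x \<in> generate G {y} <#> H \<Longrightarrow> \<exists>i::int. \<exists>h\<in>H. x = y [^] i \<otimes> h"
    if "h \<in> H" "y \<in> carrier G" for y i h
    using that by (auto simp: set_mult_def generate_pow)
  have sub: "subgroup (generate G {y} <#> H) G" if "y \<in> carrier G" for y
    using that by (intro mult_subgroups generate_is_subgroup sH) auto
  have oneH: "\<one> \<in> H"
    using sH by (rule subgroup.one_closed)
  define Q where "Q = generate G {z} <#> H"
  have sQ: "subgroup Q G"
    unfolding Q_def using z by (rule sub)
  have HQ: "h \<in> Q" if "h \<in> H" for h
    using prodI[OF that z, of 0] that Hc by (simp add: Q_def)
  have zQ: "z [^] (i::int) \<in> Q" for i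
    using prodI[OF oneH z, of i] z by (simp add: Q_def)
  have QI: "x \<in> Q" if x: "x \<in> carrier G" for x
  proof (rule ccontr)
    assume xQ: "x \<notin> Q"
    \<comment> \<open>At the least \<open>j\<close> the power enters \<open>Q\<close>, and
      \<open>j\<close> is positive, so the preceding power \<open>y\<close> lies outside
      \<open>Q\<close> while its \<open>p\<close>-th power lies inside.\<close>
    define j where "j = (LEAST j. x [^] (p ^ j) \<in> Q)"
    have "x [^] (p ^ Suc k) \<in> Q"
      using exp[OF x] sQ subgroup.one_closed by fastforce
    then have jQ: "x [^] (p ^ j) \<in> Q"
      unfolding j_def by (rule LeastI)
    then have "j \<noteq> 0"
      using xQ x by (metis power_0 nat_pow_eone)
    then obtain j' where j': "j = Suc j'"
      by (cases j) auto
    define y where "y = x [^] (p ^ j')"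
    have y: "y \<in> carrier G"
      using x by (simp add: y_def)
    have yQ: "y \<notin> Q"
      using not_less_Least[of j' "\<lambda>j. x [^] (p ^ j) \<in> Q"] by (simp add: y_def j_def[symmetric] j')
    have "y [^] p \<in> Q"
      using jQ x by (simp add: y_def j' nat_pow_pow mult.commute)
    then obtain a :: int and h where h: "h \<in> H" and yp: "y [^] p = z [^] a \<otimes> h"
      unfolding Q_def using prodD[OF oneH z] by blast
    have hc: "h \<in> carrier G"
      using h by (rule Hc)
    \<comment> \<open>Raising to the power \<open>p ^ k\<close> kills the left side by the exponent
      bound and puts a power of \<open>z\<close> into \<open>H\<close>. That power is trivial, and
      since \<open>z\<close> has the full order \<open>p ^ Suc k\<close>, the prime divides
      \<open>a\<close>.\<close>
    have "\<one> = (y [^] p) [^] (p ^ k)"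
      using exp[OF y] y by (simp add: nat_pow_pow)
    also have "\<dots> = (z [^] a \<otimes> h) [^] int (p ^ k)"
      by (simp only: yp int_pow_int)
    also have "\<dots> = z [^] (a * int (p ^ k)) \<otimes> h [^] int (p ^ k)"
      using z hc by (simp add: int_pow_distrib int_pow_pow)
    finally have "z [^] (a * int (p ^ k)) = inv (h [^] int (p ^ k))"
      using z hc by (metis inv_equality int_pow_closed)
    moreover have "inv (h [^] int (p ^ k)) \<in> H"
      using h sH by (simp add: subgroup.m_inv_closed subgroup_int_pow_closed del: of_nat_power)
    ultimately have "z [^] (a * int (p ^ k)) = \<one>"
      using Hz by metis
    then have "int p ^ Suc k dvd a * int p ^ k"
      using z by (simp add: int_pow_eq_id ordz)
    then have "int p dvd a"
      using prime_gt_0_nat[OF p] by simp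
    then obtain b where b: "a = int p * b"
      by auto
    \<comment> \<open>The correction removes the \<open>z\<close>-part: the \<open>p\<close>-th
      power of \<open>y'\<close> is \<open>h\<close>, which lies in \<open>H\<close> itself, and
      \<open>y'\<close> is still outside \<open>Q\<close>.\<close>
    define y' where "y' = y \<otimes> z [^] (- b)"
    have y': "y' \<in> carrier G"
      using y z by (simp add: y'_def)
    have y'Q: "y' \<notin> Q"
    proof
      assume "y' \<in> Q"
      then have "y' \<otimes> z [^] b \<in> Q"
        by (rule subgroup.m_closed[OF sQ _ zQ])
      then show False
        using yQ y z by (simp add: y'_def m_assoc flip: int_pow_mult)
    qed
    have y'p: "y' [^] int p = h"
    proof -
      have "y' [^] int p = y [^] int p \<otimes> z [^] (- a)"
        using y z by (simp add: y'_def int_pow_distrib int_pow_pow b mult.commute)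
      also have "\<dots> = h \<otimes> (z [^] a \<otimes> z [^] (- a))"
        using z hc by (simp add: int_pow_int yp m_ac)
      finally show ?thesis
        using z hc by (simp flip: int_pow_mult)
    qed
    define H' where "H' = generate G {y'} <#> H"
    have "H \<subseteq> H'"
    proof
      fix g assume g: "g \<in> H"
      then show "g \<in> H'"
        using prodI[OF g y', of 0] Hc by (simp add: H'_def)
    qed
    moreover have "y' \<in> H'"
      using prodI[OF oneH y', of 1] y' by (simp add: H'_def)
    moreover have "y' \<notin> H"
      using y'Q HQ by blast
    ultimately have "H' \<notin> S"
      using Hmax by blast
    then obtain i :: int where "z [^] i \<in> H'" and zi: "z [^] i \<noteq> \<one>"
      unfolding S_def using sub[OF y'] by (auto simp: H'_def)
    then obtain m :: int and g where g: "g \<in> H" and zig: "z [^] i = y' [^] m \<otimes> g"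
      unfolding H'_def using prodD[OF oneH y'] by blast
    \<comment> \<open>If \<open>p\<close> divides \<open>m\<close>, the power of \<open>y'\<close>
      is a power of \<open>h\<close>, so a nontrivial power of \<open>z\<close> lies in
      \<open>H\<close>. Otherwise Bezout recovers \<open>y'\<close> from its \<open>m\<close>-th and
      \<open>p\<close>-th powers, both in \<open>Q\<close>.\<close>
    show False
    proof (cases "int p dvd m")
      case True
      then obtain m' where "m = int p * m'"
        by auto
      then have "y' [^] m = h [^] m'"
        using y' by (simp add: y'p flip: int_pow_pow)
      then have "z [^] i \<in> H"
        unfolding zig using g h sH by (simp add: subgroup.m_closed subgroup_int_pow_closed)
      then show False
        using Hz zi by blast
    next
      case False
      then have "coprime m (int p)"
        using p by (metis coprime_commute prime_imp_coprime prime_nat_int_transfer)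
      then obtain u v where uv: "m * u + int p * v = 1"
        using bezout_int[of m "int p"] by (metis coprime_imp_gcd_eq_1 mult.commute)
      have "y' [^] m = z [^] i \<otimes> inv g"
        using zig y' g Hc z by (metis inv_solve_right int_pow_closed m_comm)
      then have "y' [^] m \<in> Q"
        using zQ HQ g sH sQ by (simp add: subgroup.m_closed subgroup.m_inv_closed)
      then have "(y' [^] m) [^] u \<otimes> (y' [^] int p) [^] v \<in> Q"
        using HQ[OF h] sQ by (simp add: y'p subgroup.m_closed subgroup_int_pow_closed)
      then have "y' \<in> Q"
        using y' uv by (simp add: int_pow_pow flip: int_pow_mult)
      then show False
        using y'Q by blast
    qed
  qed
  show thesis
  proof (rule that[OF sH Hz])
    show "\<exists>i::int. \<exists>h\<in>H. x = z [^] i \<otimes> h" if "x \<in> carrier G" for x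
      using QI[OF that] prodD[OF oneH z] unfolding Q_def by blast
  qed
qed

text \<open>The map sends \<open>(i, h)\<close> to the product of the \<open>i\<close>-th power of
  \<open>z\<close> with \<open>h\<close>. Reduction of exponents modulo \<open>n\<close> is harmless
  because \<open>n\<close> is the order of \<open>z\<close>; trivial intersection gives injectivity
  and \<open>cover\<close> gives surjectivity.\<close>

lemma (in comm_group) iso_integer_mod_DirProd:
  assumes z: "z \<in> carrier G" and n: "ord z = n" "n > 0" and H: "subgroup H G"
    and triv: "\<And>i::int. z [^] i \<in> H \<Longrightarrow> z [^] i = \<one>"
    and cover: "\<And>x. x \<in> carrier G \<Longrightarrow> \<exists>i::int. \<exists>h\<in>H. x = z [^] i \<otimes> h"
  shows "G \<cong> integer_mod_group n \<times>\<times> G\<lparr>carrier := H\<rparr>"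
proof -
  let ?f = "\<lambda>(i::int, h). z [^] i \<otimes> h"
  have Hc: "h \<in> carrier G" if "h \<in> H" for h
    using that H by (rule subgroup.mem_carrier[rotated])
  have zmod: "z [^] (i mod int n) = z [^] i" for i
    using z by (simp add: int_pow_eq n minus_mod_eq_mult_div)
  have grp: "group (integer_mod_group n \<times>\<times> G\<lparr>carrier := H\<rparr>)"
    using H by (simp add: DirProd_group subgroup_imp_group)
  have "?f \<in> hom (integer_mod_group n \<times>\<times> G\<lparr>carrier := H\<rparr>) G"
  proof (rule homI)
    fix x y
    assume "x \<in> carrier (integer_mod_group n \<times>\<times> G\<lparr>carrier := H\<rparr>)"
      and "y \<in> carrier (integer_mod_group n \<times>\<times> G\<lparr>carrier := H\<rparr>)"
    then show "?f (x \<otimes>\<^bsub>integer_mod_group n \<times>\<times> G\<lparr>carrier := H\<rparr>\<^esub> y) = ?f x \<otimes> ?f y"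
      using z Hc by (auto simp: zmod int_pow_mult m_ac split: prod.splits)
  qed (use z Hc in auto)
  moreover have "bij_betw ?f (carrier (integer_mod_group n \<times>\<times> G\<lparr>carrier := H\<rparr>)) (carrier G)"
  proof (rule bij_betw_imageI)
    show "inj_on ?f (carrier (integer_mod_group n \<times>\<times> G\<lparr>carrier := H\<rparr>))"
    proof (rule inj_onI, clarsimp)
      fix i g j h
      assume i: "i \<in> carrier (integer_mod_group n)" and j: "j \<in> carrier (integer_mod_group n)"
        and g: "g \<in> H" and h: "h \<in> H" and eq: "z [^] i \<otimes> g = z [^] j \<otimes> h"
      have "z [^] i = (z [^] j \<otimes> h) \<otimes> inv g"
        using eq[symmetric] z g h Hc by (simp add: m_assoc)
      also have "\<dots> = z [^] j \<otimes> (h \<otimes> inv g)"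
        using z g h Hc by (simp add: m_assoc)
      finally have "z [^] (i - j) = h \<otimes> inv g"
        using z g h Hc by (simp add: int_pow_diff m_ac)
      then have "z [^] (i - j) \<in> H"
        using g h H by (simp add: subgroup.m_closed subgroup.m_inv_closed)
      then have "int n dvd i - j"
        using triv z n int_pow_eq_id by blast
      then have "i = j"
        using i j n by (auto simp: carrier_integer_mod_group dest: zdvd_imp_le)
          (metis mod_eq_dvd_iff mod_pos_pos_trivial)
      then show "i = j \<and> g = h"
        using eq z g h Hc by simp
    qed
    show "?f ` carrier (integer_mod_group n \<times>\<times> G\<lparr>carrier := H\<rparr>) = carrier G"
    proof (intro equalityI subsetI)
      fix x assume "x \<in> carrier G"
      then obtain i :: int and h where h: "h \<in> H" "x = z [^] i \<otimes> h"
        using cover by blast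
      then have "x = ?f (i mod int n, h)"
        by (simp add: zmod)
      then show "x \<in> ?f ` carrier (integer_mod_group n \<times>\<times> G\<lparr>carrier := H\<rparr>)"
        using h(1) n(2) by (intro image_eqI[of _ _ "(i mod int n, h)"]) (auto simp: carrier_integer_mod_group)
    qed (use z Hc in auto)
  qed
  ultimately have "integer_mod_group n \<times>\<times> G\<lparr>carrier := H\<rparr> \<cong> G"
    unfolding is_iso_def iso_def by blast
  then show ?thesis
    using grp by (simp add: group.iso_sym)
qed

section \<open>Rearranging products of cyclic groups\<close>

lemma group_cyclic_power [simp]: "group (cyclic_power n m)"
  by (simp add: cyclic_power_def)

lemma cyclic_power_Suc_iso:
  "integer_mod_group n \<times>\<times> cyclic_power n m \<cong> cyclic_power n (Suc m)"
proof -
  let ?f = "\<lambda>(x::int, g). g(m := x)"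
  have "?f \<in> hom (integer_mod_group n \<times>\<times> cyclic_power n m) (cyclic_power n (Suc m))"
  proof (rule homI)
    fix u assume "u \<in> carrier (integer_mod_group n \<times>\<times> cyclic_power n m)"
    then have "fst u \<in> carrier (integer_mod_group n)"
      "snd u \<in> {..<m} \<rightarrow>\<^sub>E carrier (integer_mod_group n)"
      by (simp_all add: cyclic_power_def mem_Times_iff)
    then have "(snd u)(m := fst u) \<in> insert m {..<m} \<rightarrow>\<^sub>E carrier (integer_mod_group n)"
      by (rule PiE_fun_upd)
    then show "?f u \<in> carrier (cyclic_power n (Suc m))"
      by (simp add: cyclic_power_def lessThan_Suc case_prod_beta)
  next
    fix u v
    show "?f (u \<otimes>\<^bsub>integer_mod_group n \<times>\<times> cyclic_power n m\<^esub> v) =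
        ?f u \<otimes>\<^bsub>cyclic_power n (Suc m)\<^esub> ?f v"
      by (simp add: cyclic_power_def fun_eq_iff restrict_def less_Suc_eq mult_DirProd' case_prod_beta)
  qed
  moreover have "bij_betw ?f (carrier (integer_mod_group n \<times>\<times> cyclic_power n m))
      (carrier (cyclic_power n (Suc m)))"
  proof (rule bij_betw_imageI)
    show "inj_on ?f (carrier (integer_mod_group n \<times>\<times> cyclic_power n m))"
      using inj_combinator[of m "{..<m}" "\<lambda>_. carrier (integer_mod_group n)"]
      by (simp add: cyclic_power_def)
    show "?f ` carrier (integer_mod_group n \<times>\<times> cyclic_power n m) = carrier (cyclic_power n (Suc m))"
      unfolding cyclic_power_def lessThan_Suc carrier_product_group PiE_insert_eq carrier_DirProd ..
  qed
  ultimately show ?thesis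
    unfolding is_iso_def iso_def by blast
qed

lemma DirProd_iso_left_comm: "A \<times>\<times> (B \<times>\<times> C) \<cong> B \<times>\<times> (A \<times>\<times> C)"
proof -
  have "(\<lambda>(a, b, c). (b, a, c)) \<in> iso (A \<times>\<times> (B \<times>\<times> C)) (B \<times>\<times> (A \<times>\<times> C))"
    by (auto simp: iso_def hom_def inj_on_def bij_betw_def image_iff)
  then show ?thesis
    unfolding is_iso_def by blast
qed

lemma DirProd_iso_cong_left: "A \<cong> A' \<Longrightarrow> group A \<Longrightarrow> A \<times>\<times> B \<cong> A' \<times>\<times> B"
  by (rule group.DirProd_iso_trans) (auto simp: iso_refl)

lemma DirProd_iso_cong_right: "B \<cong> B' \<Longrightarrow> group A \<Longrightarrow> A \<times>\<times> B \<cong> A \<times>\<times> B'"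
  by (rule group.DirProd_iso_trans) (auto simp: iso_refl)

lemma DirProd_assoc_iso: "A \<times>\<times> (B \<times>\<times> C) \<cong> (A \<times>\<times> B) \<times>\<times> C"
proof -
  have "(\<lambda>(a, b, c). ((a, b), c)) \<in> iso (A \<times>\<times> (B \<times>\<times> C)) ((A \<times>\<times> B) \<times>\<times> C)"
    by (auto simp: iso_def hom_def inj_on_def bij_betw_def image_iff)
  then show ?thesis
    unfolding is_iso_def by blast
qed

lemma cyclic_power_absorb_iso:
  "integer_mod_group n \<times>\<times> cyclic_power n m \<times>\<times> C \<cong> cyclic_power n (Suc m) \<times>\<times> C"
  by (rule iso_trans[OF DirProd_assoc_iso DirProd_iso_cong_left[OF cyclic_power_Suc_iso]])
    (simp add: DirProd_group)

text \<open>A cyclic subgroup of maximal order splits off, so induction on the order applies.\<close>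

lemma finite_abelian_exponent_cube_decomposition:
  fixes G :: "('a, 'b) monoid_scheme"
  assumes "comm_group G" and "finite (carrier G)" and p: "prime p"
    and "\<And>x. x \<in> carrier G \<Longrightarrow> x [^]\<^bsub>G\<^esub> (p ^ 3) = \<one>\<^bsub>G\<^esub>"
  shows "\<exists>a b c. G \<cong> cyclic_power p a \<times>\<times> cyclic_power (p\<^sup>2) b \<times>\<times> cyclic_power (p ^ 3) c"
  using assms(1,2,4)
proof (induction "card (carrier G)" arbitrary: G rule: less_induct)
  case less
  interpret comm_group G
    by fact
  let ?C = "\<lambda>a b c. cyclic_power p a \<times>\<times> cyclic_power (p\<^sup>2) b \<times>\<times> cyclic_power (p ^ 3) c"
  \<comment> \<open>When \<open>p ^ e\<close> kills the group and \<open>z\<close> survives the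
    exponent one lower, \<open>z\<close> has the maximal order \<open>p ^ e\<close>. It splits off,
    and the strictly smaller complement is handled by induction.\<close>
  have split: "\<exists>a b c. G \<cong> integer_mod_group (p ^ e) \<times>\<times> ?C a b c"
    if e: "e = Suc k"
      and exp': "\<And>x. x \<in> carrier G \<Longrightarrow> x [^]\<^bsub>G\<^esub> (p ^ e) = \<one>\<^bsub>G\<^esub>"
      and z: "z \<in> carrier G" and zk: "z [^]\<^bsub>G\<^esub> (p ^ k) \<noteq> \<one>\<^bsub>G\<^esub>" for z k e
  proof -
    note exp = exp'[unfolded e]
    have "ord z dvd p ^ Suc k" "\<not> ord z dvd p ^ k"
      using exp[OF z] zk z by (simp_all add: pow_eq_id)
    then have ordz: "ord z = p ^ Suc k"
      using p by (metis divides_primepow_nat le_Suc_eq le_imp_power_dvd)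
    obtain H where H: "subgroup H G"
      and Hz: "\<And>i::int. z [^]\<^bsub>G\<^esub> i \<in> H \<Longrightarrow> z [^]\<^bsub>G\<^esub> i = \<one>\<^bsub>G\<^esub>"
      and cover: "\<And>x. x \<in> carrier G \<Longrightarrow> \<exists>i::int. \<exists>h\<in>H. x = z [^]\<^bsub>G\<^esub> i \<otimes>\<^bsub>G\<^esub> h"
      using cyclic_complement[OF less.prems(2) p exp z ordz] by blast
    have iso: "G \<cong> integer_mod_group (p ^ Suc k) \<times>\<times> G\<lparr>carrier := H\<rparr>"
      by (rule iso_integer_mod_DirProd[OF z ordz _ H Hz cover]) (simp add: prime_gt_0_nat[OF p])
    have "z \<noteq> \<one>\<^bsub>G\<^esub>"
      using zk by auto
    then have "z \<notin> H"
      using Hz[of 1] z by auto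
    then have "H \<subset> carrier G"
      using subgroup.subset[OF H] z by blast
    then have "card H < card (carrier G)"
      using less.prems(2) by (rule psubset_card_mono[rotated])
    moreover have "comm_group (G\<lparr>carrier := H\<rparr>)"
      using H by (rule comm_group_subgroup)
    moreover have "x [^]\<^bsub>G\<lparr>carrier := H\<rparr>\<^esub> (p ^ 3) = \<one>\<^bsub>G\<lparr>carrier := H\<rparr>\<^esub>"
      if "x \<in> carrier (G\<lparr>carrier := H\<rparr>)" for x
      using that less.prems(3)[of x] subgroup.mem_carrier[OF H] by (simp flip: nat_pow_consistent)
    moreover have "finite H"
      using \<open>H \<subset> carrier G\<close> less.prems(2) finite_subset by blast
    ultimately obtain a b c where "G\<lparr>carrier := H\<rparr> \<cong> ?C a b c"
      using less.hyps[of "G\<lparr>carrier := H\<rparr>"] by auto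
    then have "G \<cong> integer_mod_group (p ^ Suc k) \<times>\<times> ?C a b c"
      using iso_trans[OF iso DirProd_iso_cong_right] by simp
    then show ?thesis
      unfolding e by blast
  qed
  \<comment> \<open>The cases are the exact exponent of the group: \<open>p ^ 3\<close>,
    \<open>p ^ 2\<close>, \<open>p\<close> or \<open>1\<close>. In the first three, \<open>z\<close>
    witnesses that a smaller exponent fails.\<close>
  consider (three) z where "z \<in> carrier G" "z [^]\<^bsub>G\<^esub> (p ^ 2) \<noteq> \<one>\<^bsub>G\<^esub>"
    | (two) z where "z \<in> carrier G" "z [^]\<^bsub>G\<^esub> (p ^ 1) \<noteq> \<one>\<^bsub>G\<^esub>" "\<And>x. x \<in> carrier G \<Longrightarrow> x [^]\<^bsub>G\<^esub> (p ^ 2) = \<one>\<^bsub>G\<^esub>"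
    | (one) z where "z \<in> carrier G" "z [^]\<^bsub>G\<^esub> (p ^ 0) \<noteq> \<one>\<^bsub>G\<^esub>" "\<And>x. x \<in> carrier G \<Longrightarrow> x [^]\<^bsub>G\<^esub> (p ^ 1) = \<one>\<^bsub>G\<^esub>"
    | (zero) "\<And>x. x \<in> carrier G \<Longrightarrow> x = \<one>\<^bsub>G\<^esub>"
    by (metis nat_pow_eone power_0)
  then show ?case
  proof cases
    case three
    then obtain a b c where "G \<cong> integer_mod_group (p ^ 3) \<times>\<times> ?C a b c"
      using split[of 3 2 z] less.prems(3) by auto
    moreover have "integer_mod_group (p ^ 3) \<times>\<times> ?C a b c \<cong>
        cyclic_power p a \<times>\<times> (integer_mod_group (p ^ 3) \<times>\<times> (cyclic_power (p\<^sup>2) b \<times>\<times> cyclic_power (p ^ 3) c))"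
      by (rule DirProd_iso_left_comm)
    moreover have "\<dots> \<cong>
        cyclic_power p a \<times>\<times> (cyclic_power (p\<^sup>2) b \<times>\<times> (integer_mod_group (p ^ 3) \<times>\<times> cyclic_power (p ^ 3) c))"
      by (intro DirProd_iso_cong_right DirProd_iso_left_comm group_cyclic_power)
    moreover have "\<dots> \<cong> ?C a b (Suc c)"
      by (intro DirProd_iso_cong_right cyclic_power_Suc_iso group_cyclic_power)
    ultimately have "G \<cong> ?C a b (Suc c)"
      by (meson iso_trans)
    then show ?thesis
      by blast
  next
    case two
    then obtain a b c where "G \<cong> integer_mod_group (p\<^sup>2) \<times>\<times> ?C a b c"
      using split[of 2 1 z] by auto
    moreover have "integer_mod_group (p\<^sup>2) \<times>\<times> ?C a b c \<cong>
        cyclic_power p a \<times>\<times> (integer_mod_group (p\<^sup>2) \<times>\<times> (cyclic_power (p\<^sup>2) b \<times>\<times> cyclic_power (p ^ 3) c))"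
      by (rule DirProd_iso_left_comm)
    moreover have "\<dots> \<cong> ?C a (Suc b) c"
      by (intro DirProd_iso_cong_right cyclic_power_absorb_iso group_cyclic_power)
    ultimately have "G \<cong> ?C a (Suc b) c"
      by (meson iso_trans)
    then show ?thesis
      by blast
  next
    case one
    then obtain a b c where "G \<cong> integer_mod_group p \<times>\<times> ?C a b c"
      using split[of 1 0 z] by auto
    then have "G \<cong> ?C (Suc a) b c"
      using cyclic_power_absorb_iso iso_trans by blast
    then show ?thesis
      by blast
  next
    case zero
    have "card (carrier (?C 0 0 0)) = 1"
      by (simp add: cyclic_power_def card_cartesian_product)
    then have "trivial_group (?C 0 0 0)"
      by (auto simp: trivial_group_def cyclic_power_def DirProd_group)
    moreover have "trivial_group G"
      using zero by (auto simp: trivial_group_def)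
    ultimately have "(\<lambda>_. \<one>\<^bsub>?C 0 0 0\<^esub>) \<in> iso G (?C 0 0 0)"
      unfolding trivial_group_def iso_def hom_def bij_betw_def
      by (auto simp: group.is_monoid monoid.r_one)
    then show ?thesis
      unfolding is_iso_def by blast
  qed
qed

text \<open>This is the intersection of the \<open>p ^ j\<close>-th powers with the elements killed
  by \<open>p\<close>. In a finite abelian \<open>p\<close>-group its order is \<open>p\<close> to
  the number of cyclic summands of order at least \<open>p ^ Suc j\<close>, so the layers determine
  the isomorphism type.\<close>

definition torsion_layer :: "nat \<Rightarrow> nat \<Rightarrow> ('a, 'b) monoid_scheme \<Rightarrow> 'a set" where
  "torsion_layer p j G =
     (\<lambda>y. y [^]\<^bsub>G\<^esub> (p ^ j)) ` {y \<in> carrier G. y [^]\<^bsub>G\<^esub> (p ^ Suc j) = \<one>\<^bsub>G\<^esub>}"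

lemma card_torsion_layer_iso:
  assumes "G \<cong> H" "group G" "group H"
  shows "card (torsion_layer p j G) = card (torsion_layer p j H)"
proof -
  obtain h where h: "h \<in> iso G H"
    using assms(1) by (auto simp: is_iso_def)
  interpret group_hom G H h
    using assms h by (auto simp: group_hom_def group_hom_axioms_def iso_def)
  have bij: "bij_betw h (carrier G) (carrier H)"
    using h by (simp add: iso_def)
  then have inj: "inj_on h (carrier G)" and surj: "h ` carrier G = carrier H"
    by (auto simp: bij_betw_def)
  have one_iff: "h x = \<one>\<^bsub>H\<^esub> \<longleftrightarrow> x = \<one>\<^bsub>G\<^esub>" if "x \<in> carrier G" for x
    using inj_onD[OF inj, of x "\<one>\<^bsub>G\<^esub>"] that by auto
  have "torsion_layer p j H = h ` torsion_layer p j G"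
    unfolding torsion_layer_def surj[symmetric]
    by (force simp: image_iff one_iff G.nat_pow_closed simp flip: hom_nat_pow)
  moreover have "inj_on h (torsion_layer p j G)"
    using inj by (rule inj_on_subset) (auto simp: torsion_layer_def)
  ultimately show ?thesis
    by (simp add: card_image)
qed

lemma pow_DirProd:
  fixes n :: nat
  shows "(x, y) [^]\<^bsub>G \<times>\<times> H\<^esub> n = (x [^]\<^bsub>G\<^esub> n, y [^]\<^bsub>H\<^esub> n)"
  by (induction n) auto

lemma torsion_layer_DirProd:
  "torsion_layer p j (G \<times>\<times> H) = torsion_layer p j G \<times> torsion_layer p j H"
  by (auto simp: torsion_layer_def pow_DirProd intro!: image_eqI)

lemma pow_product_group:
  fixes n :: nat
  shows "f [^]\<^bsub>product_group I G\<^esub> n = (\<lambda>i\<in>I. f i [^]\<^bsub>G i\<^esub> n)"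
  by (induction n) auto

lemma torsion_layer_product_group:
  "torsion_layer p j (product_group I G) = (\<Pi>\<^sub>E i\<in>I. torsion_layer p j (G i))"
proof (intro equalityI subsetI)
  fix f assume "f \<in> torsion_layer p j (product_group I G)"
  then obtain g where g: "g \<in> (\<Pi>\<^sub>E i\<in>I. carrier (G i))"
    and one: "(\<lambda>i\<in>I. g i [^]\<^bsub>G i\<^esub> (p ^ Suc j)) = (\<lambda>i\<in>I. \<one>\<^bsub>G i\<^esub>)"
    and f: "f = (\<lambda>i\<in>I. g i [^]\<^bsub>G i\<^esub> (p ^ j))"
    by (auto simp: torsion_layer_def pow_product_group simp del: power_Suc)
  have "g i [^]\<^bsub>G i\<^esub> (p ^ Suc j) = \<one>\<^bsub>G i\<^esub>" if "i \<in> I" for i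
    using fun_cong[OF one, of i] that by simp
  then show "f \<in> (\<Pi>\<^sub>E i\<in>I. torsion_layer p j (G i))"
    using g unfolding f torsion_layer_def by (intro restrict_PiE_iff[THEN iffD2] ballI imageI) auto
next
  fix f assume f: "f \<in> (\<Pi>\<^sub>E i\<in>I. torsion_layer p j (G i))"
  then have "\<forall>i\<in>I. \<exists>y. y \<in> carrier (G i) \<and> y [^]\<^bsub>G i\<^esub> (p ^ Suc j) = \<one>\<^bsub>G i\<^esub> \<and> f i = y [^]\<^bsub>G i\<^esub> (p ^ j)"
    by (auto simp: torsion_layer_def PiE_iff image_iff simp del: power_Suc)
  then obtain g where g: "\<And>i. i \<in> I \<Longrightarrow> g i \<in> carrier (G i)"
    "\<And>i. i \<in> I \<Longrightarrow> g i [^]\<^bsub>G i\<^esub> (p ^ Suc j) = \<one>\<^bsub>G i\<^esub>"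
    "\<And>i. i \<in> I \<Longrightarrow> f i = g i [^]\<^bsub>G i\<^esub> (p ^ j)"
    by metis
  have "f = (restrict g I) [^]\<^bsub>product_group I G\<^esub> (p ^ j)"
  proof
    show "f i = ((restrict g I) [^]\<^bsub>product_group I G\<^esub> (p ^ j)) i" for i
      using g(3)[of i] PiE_arb[OF f, of i] by (cases "i \<in> I") (simp_all add: pow_product_group)
  qed
  moreover have "restrict g I [^]\<^bsub>product_group I G\<^esub> (p ^ Suc j) = \<one>\<^bsub>product_group I G\<^esub>"
    using g(2) by (simp add: pow_product_group fun_eq_iff restrict_def del: power_Suc)
  moreover have "restrict g I \<in> carrier (product_group I G)"
    using g(1) by simp
  ultimately show "f \<in> torsion_layer p j (product_group I G)"
    unfolding torsion_layer_def by blast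
qed

text \<open>For \<open>j < k\<close> the elements killed by \<open>p ^ Suc j\<close> are the
  multiples of \<open>p ^ (k - Suc j)\<close>, so the layer consists of the multiples of
  \<open>p ^ (k - 1)\<close>, the subgroup of order \<open>p\<close>. For \<open>j \<ge> k\<close>
  already \<open>p ^ j\<close> annihilates the group.\<close>

lemma card_torsion_layer_integer_mod_group:
  assumes p: "p > 0"
  shows "card (torsion_layer p j (integer_mod_group (p ^ k))) = (if j < k then p else 1)"
proof (cases "j < k")
  case True
  then obtain d where k: "k = j + Suc d"
    using less_iff_Suc_add by auto
  have "torsion_layer p j (integer_mod_group (p ^ k)) = (\<lambda>t. int p ^ (j + d) * t) ` {0..<int p}"
  proof (intro equalityI subsetI)
    fix x assume "x \<in> torsion_layer p j (integer_mod_group (p ^ k))"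
    then obtain y where y: "int p ^ k dvd int p ^ Suc j * y" and x: "x = int p ^ j * y mod int p ^ k"
      by (auto simp: torsion_layer_def mod_eq_0_iff_dvd)
    have "int p ^ Suc j * int p ^ d dvd int p ^ Suc j * y"
      using y by (simp add: k power_add ac_simps)
    then obtain t where t: "y = int p ^ d * t"
      using p by (auto simp: dvd_def)
    have "x = int p ^ (j + d) * (t mod int p)"
      by (simp add: x t k power_add mod_mult_mult1 mult.assoc mult.left_commute
          flip: mult_mod_right)
    then show "x \<in> (\<lambda>t. int p ^ (j + d) * t) ` {0..<int p}"
      using p by auto
  next
    fix x assume "x \<in> (\<lambda>t. int p ^ (j + d) * t) ` {0..<int p}"
    then obtain t where t: "0 \<le> t" "t < int p" and x: "x = int p ^ (j + d) * t"
      by auto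
    have "int p ^ d * t < int p ^ d * int p"
      using t p by simp
    also have "\<dots> \<le> int p ^ d * int p * int p ^ j"
      using p by simp
    finally have "int p ^ d * t < int p ^ k"
      by (simp add: k power_add ac_simps)
    moreover have "x < int p ^ k"
      using t p by (simp add: x k power_add)
    ultimately show "x \<in> torsion_layer p j (integer_mod_group (p ^ k))"
      unfolding torsion_layer_def using t p
      by (intro image_eqI[of _ _ "int p ^ d * t"])
        (auto simp: x carrier_integer_mod_group k power_add ac_simps mod_eq_0_iff_dvd)
  qed
  moreover have "inj_on (\<lambda>t. int p ^ (j + d) * t) {0..<int p}"
    using p by (auto simp: inj_on_def)
  ultimately show ?thesis
    using True by (simp add: card_image)
next
  case False
  then have "int p ^ k dvd int p ^ j * y" for y
    by (simp add: le_imp_power_dvd)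
  then have "torsion_layer p j (integer_mod_group (p ^ k)) = {0}"
    using p by (force simp: torsion_layer_def carrier_integer_mod_group mod_eq_0_iff_dvd image_iff)
  then show ?thesis
    using False by simp
qed

lemma card_torsion_layer_cyclic_power:
  assumes "p > 0"
  shows "card (torsion_layer p j (cyclic_power (p ^ k) m)) = (if j < k then p ^ m else 1)"
  using card_torsion_layer_integer_mod_group[OF assms, of j k]
  by (simp add: cyclic_power_def torsion_layer_product_group card_PiE)

text \<open>The three layers recover \<open>a\<close>, \<open>b\<close> and \<open>c\<close>. The
  order of the whole group is recorded because its being a power of \<open>p\<close> identifies the
  torsion part with the Sylow subgroup.\<close>

lemma card_torsion_layer_cube_decomposition:
  assumes G: "group G" "G \<cong> cyclic_power p a \<times>\<times> cyclic_power (p\<^sup>2) b \<times>\<times> cyclic_power (p ^ 3) c"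
    and p: "p > 0"
  shows "card (torsion_layer p 0 G) = p ^ (a + b + c)"
    and "card (torsion_layer p 1 G) = p ^ (b + c)"
    and "card (torsion_layer p 2 G) = p ^ c"
    and "card (carrier G) = p ^ (a + 2 * b + 3 * c)"
proof -
  have "card (torsion_layer p j G) = card (torsion_layer p j (cyclic_power (p ^ 1) a)) *
      card (torsion_layer p j (cyclic_power (p ^ 2) b)) *
      card (torsion_layer p j (cyclic_power (p ^ 3) c))" for j
    using card_torsion_layer_iso[OF G(2,1)]
    by (simp add: DirProd_group torsion_layer_DirProd card_cartesian_product mult.assoc)
  note * = this[unfolded card_torsion_layer_cyclic_power[OF p]]
  show "card (torsion_layer p 0 G) = p ^ (a + b + c)" "card (torsion_layer p 1 G) = p ^ (b + c)"
    "card (torsion_layer p 2 G) = p ^ c"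
    unfolding * by (simp_all add: power_add)
  have "card (carrier (cyclic_power (p ^ k) m)) = p ^ (k * m)" for k m
    using p by (simp add: cyclic_power_def card_PiE carrier_integer_mod_group power_mult nat_power_eq)
  from this[of 1 a] this[of 2 b] this[of 3 c] show "card (carrier G) = p ^ (a + 2 * b + 3 * c)"
    using iso_same_card[OF G(2)] by (simp add: card_cartesian_product power_add)
qed

section \<open>The Sylow subgroup as a torsion subgroup\<close>

lemma (in comm_group) subgroup_pow_eq_one:
  fixes n :: nat
  shows "subgroup {x \<in> carrier G. x [^] n = \<one>} G"
  by (rule subgroupI) (auto simp: nat_pow_inv nat_pow_distrib)

text \<open>An element of the Sylow subgroup has order a power of \<open>p\<close> dividing
  \<open>p ^ k * n\<close>, hence dividing \<open>p ^ k\<close>; this gives one inclusion.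
  Conversely the torsion part has \<open>p\<close>-power order dividing the group order, so it is no
  larger than the Sylow subgroup.\<close>

lemma (in comm_group) syl_eq_pow_eq_one:
  assumes fin: "finite (carrier G)" and p: "prime p" and "coprime p n"
    and exp: "\<And>x. x \<in> carrier G \<Longrightarrow> x [^] (p ^ k * n) = \<one>"
    and card: "card {x \<in> carrier G. x [^] (p ^ k) = \<one>} = p ^ b"
  shows "syl p G = G\<lparr>carrier := {x \<in> carrier G. x [^] (p ^ k) = \<one>}\<rparr>"
proof -
  let ?T = "{x \<in> carrier G. x [^] (p ^ k) = \<one>}"
  obtain P where P: "is_sylow p G P" and uniq: "\<And>Q. is_sylow p G Q \<Longrightarrow> Q = P"
    using ex1_sylow[OF fin p] by blast
  have sP: "subgroup P G" and cP: "card P = p ^ multiplicity p (Coset.order G)"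
    using P by (auto simp: is_sylow_def)
  interpret P: group "G\<lparr>carrier := P\<rparr>"
    using sP by (rule subgroup_imp_group)
  have "P \<subseteq> ?T"
  proof
    fix x assume x: "x \<in> P"
    then have xG: "x \<in> carrier G"
      using sP by (rule subgroup.mem_carrier[rotated])
    have "x [^] card P = \<one>"
      using P.pow_order_eq_1[of x] x by (simp add: Coset.order_def flip: nat_pow_consistent)
    then have "ord x dvd p ^ multiplicity p (Coset.order G)"
      using xG by (simp add: pow_eq_id cP)
    moreover from this have "coprime (ord x) n"
      using \<open>coprime p n\<close> by (meson coprime_divisors coprime_power_left_iff dvd_refl)
    moreover have "ord x dvd p ^ k * n"
      using exp[OF xG] xG by (simp add: pow_eq_id)
    ultimately have "ord x dvd p ^ k"
      by (simp add: coprime_dvd_mult_left_iff)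
    then show "x \<in> ?T"
      using xG by (simp add: pow_eq_id)
  qed
  moreover have "card ?T \<le> card P"
  proof -
    have "card ?T dvd Coset.order G"
      using dvd_triv_right[of "card ?T" "card (rcosets ?T)"] lagrange[OF subgroup_pow_eq_one[of "p ^ k"]] by simp
    moreover have "Coset.order G \<noteq> 0"
      using fin order_gt_0_iff_finite by simp
    moreover have "\<not> is_unit p"
      using p by (simp add: prime_nat_iff)
    ultimately have "b \<le> multiplicity p (Coset.order G)"
      unfolding card by (intro multiplicity_geI)
    then show ?thesis
      unfolding card cP using prime_ge_1_nat[OF p] by (rule power_increasing)
  qed
  ultimately have "P = ?T"
    using fin by (intro card_seteq) auto
  moreover have "(THE P. is_sylow p G P) = P"
    using P uniq by (rule the_equality)
  ultimately show ?thesis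
    by (simp add: syl_def)
qed

section \<open>Reduction of lattices modulo a prime\<close>

definition add_subgroup :: "'a::ab_group_add set \<Rightarrow> bool" where
  "add_subgroup U \<longleftrightarrow> 0 \<in> U \<and> (\<forall>x\<in>U. \<forall>y\<in>U. x - y \<in> U)"

lemma add_subgroup_zero: "add_subgroup U \<Longrightarrow> 0 \<in> U"
  by (simp add: add_subgroup_def)

lemma add_subgroup_UNIV: "add_subgroup UNIV"
  by (simp add: add_subgroup_def)

lemma add_subgroup_diff: "add_subgroup U \<Longrightarrow> x \<in> U \<Longrightarrow> y \<in> U \<Longrightarrow> x - y \<in> U"
  by (simp add: add_subgroup_def)

lemma add_subgroup_add:
  assumes "add_subgroup U" "x \<in> U" "y \<in> U"
  shows "x + y \<in> U"
proof -
  have "0 - y \<in> U"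
    by (rule add_subgroup_diff[OF assms(1) add_subgroup_zero[OF assms(1)] assms(3)])
  then have "x - (0 - y) \<in> U"
    by (rule add_subgroup_diff[OF assms(1,2)])
  then show ?thesis
    by simp
qed

lemma add_subgroup_scale:
  fixes x :: "int ^ 'n"
  assumes U: "add_subgroup U" "x \<in> U"
  shows "c *s x \<in> U"
proof (induction c rule: int_induct[where k = 0])
  case base
  then show ?case
    using U by (simp add: add_subgroup_zero)
next
  case (step1 i)
  then have "i *s x + x \<in> U"
    using U by (simp add: add_subgroup_add)
  then show ?case
    by (simp add: vector_sadd_rdistrib)
next
  case (step2 i)
  then have "i *s x - x \<in> U"
    using U by (simp add: add_subgroup_diff)
  moreover have "(i - 1) *s x = i *s x - x"
    by (simp add: vec_eq_iff algebra_simps)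
  ultimately show ?case
    by simp
qed

text \<open>Both images are in bijection with the classes of \<open>A\<close> under the common
  relation of having equal values.\<close>

lemma card_image_same_fibers:
  assumes "\<And>x y. x \<in> A \<Longrightarrow> y \<in> A \<Longrightarrow> f x = f y \<longleftrightarrow> g x = g y"
  shows "card (f ` A) = card (g ` A)"
proof -
  have inv: "inv_into A g (g x) \<in> A" "g (inv_into A g (g x)) = g x" if "x \<in> A" for x
    using that by (auto intro: inv_into_into f_inv_into_f)
  then have eq: "f (inv_into A g (g x)) = f x" if "x \<in> A" for x
    using assms that by blast
  have "bij_betw (\<lambda>s. f (inv_into A g s)) (g ` A) (f ` A)"
  proof (rule bij_betw_imageI)
    show "inj_on (\<lambda>s. f (inv_into A g s)) (g ` A)"
      using assms by (auto simp: inj_on_def eq)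
    show "(\<lambda>s. f (inv_into A g s)) ` g ` A = f ` A"
      unfolding image_image by (rule image_cong[OF refl eq])
  qed
  then show ?thesis
    by (simp add: bij_betw_same_card)
qed

text \<open>This is the tower law for indices, |U/Z| = |U/W| |W/Z|. Quotients are represented by
  images of functions whose fibres are cosets: \<open>f\<close> stands for U/W and \<open>g\<close>
  for U/Z and W/Z. No homomorphism property is asked of \<open>f\<close> or
  \<open>g\<close>.\<close>

lemma card_image_add_subgroup:
  assumes U: "add_subgroup U" and W: "add_subgroup W" "W \<subseteq> U" and "Z \<subseteq> W"
    and f: "\<And>x y. x \<in> U \<Longrightarrow> y \<in> U \<Longrightarrow> f x = f y \<longleftrightarrow> x - y \<in> W"
    and g: "\<And>x y. x \<in> U \<Longrightarrow> y \<in> U \<Longrightarrow> g x = g y \<longleftrightarrow> x - y \<in> Z"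
    and fin: "finite (g ` U)"
  shows "card (g ` U) = card (f ` U) * card (g ` W)"
proof -
  have gf: "f x = f y" if "x \<in> U" "y \<in> U" "g x = g y" for x y
    using that f g \<open>Z \<subseteq> W\<close> by blast
  have "f ` U = (\<lambda>c. f (inv_into U g c)) ` g ` U"
    unfolding image_image
    by (rule image_cong[OF refl]) (rule gf, auto intro: inv_into_into f_inv_into_f[symmetric])
  then have finf: "finite (f ` U)"
    using fin by simp
  \<comment> \<open>\<open>F c\<close> is the part of the \<open>g\<close>-image lying over
    \<open>c\<close>, that is, the image of one coset of \<open>W\<close>; translation gives all
    these parts equal size.\<close>
  define F where "F c = g ` {y \<in> U. f y = c}" for c
  have un: "g ` U = (\<Union>c\<in>f ` U. F c)"
    by (auto simp: F_def)
  have cardF: "card (F c) = card (g ` W)" if "c \<in> f ` U" for c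
  proof -
    obtain x where x: "x \<in> U" "c = f x"
      using \<open>c \<in> f ` U\<close> by auto
    have Fc: "F c = (\<lambda>w. g (x + w)) ` W"
    proof (intro equalityI subsetI)
      fix t assume "t \<in> F c"
      then obtain y where y: "y \<in> U" "f y = f x" "t = g y"
        by (auto simp: F_def x)
      then have "y - x \<in> W"
        using f x by blast
      then show "t \<in> (\<lambda>w. g (x + w)) ` W"
        by (intro image_eqI[of _ _ "y - x"]) (auto simp: y)
    next
      fix t assume "t \<in> (\<lambda>w. g (x + w)) ` W"
      then obtain w where w: "w \<in> W" "t = g (x + w)"
        by auto
      then have "x + w \<in> U"
        using W x U by (intro add_subgroup_add) auto
      then show "t \<in> F c"
        using w x f by (auto simp: F_def intro!: imageI)
    qed
    have "g (x + w) = g (x + w') \<longleftrightarrow> g w = g w'" if "w \<in> W" "w' \<in> W" for w w'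
      using that x W U g[of "x + w" "x + w'"] g[of w w'] by (auto simp: add_subgroup_add subset_iff)
    then show ?thesis
      unfolding Fc by (rule card_image_same_fibers)
  qed
  have "card (g ` U) = (\<Sum>c\<in>f ` U. card (F c))"
    unfolding un
  proof (rule card_UN_disjoint[OF finf])
    show "\<forall>c\<in>f ` U. finite (F c)"
      using fin by (auto simp: F_def intro: finite_subset[OF image_mono])
    show "\<forall>c\<in>f ` U. \<forall>d\<in>f ` U. c \<noteq> d \<longrightarrow> F c \<inter> F d = {}"
      unfolding F_def using gf by blast
  qed
  then show ?thesis
    by (simp add: cardF)
qed

text \<open>In characteristic \<open>p\<close> this is reduction modulo \<open>p\<close>, over the
  reals it is the inclusion. One map for both makes ranks of a lattice over different fields
  comparable.\<close>

definition of_int_vec :: "int ^ 'n \<Rightarrow> 'a::ring_1 ^ 'n" where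
  "of_int_vec x = (\<chi> i. of_int (x $ i))"

lemma of_int_vec_nth [simp]: "of_int_vec x $ i = of_int (x $ i)"
  by (simp add: of_int_vec_def)

lemma of_int_vec_0 [simp]: "of_int_vec 0 = 0"
  and of_int_vec_diff: "of_int_vec (x - y) = of_int_vec x - of_int_vec y"
  and of_int_vec_scale: "of_int_vec (c *s x) = of_int c *s of_int_vec x"
  by (simp_all add: vec_eq_iff)

lemma of_int_vec_mult:
  "of_int_vec (A *v x) = (map_matrix of_int A :: 'a::comm_ring_1 ^ 'n ^ 'm) *v of_int_vec x"
  by (simp add: vec_eq_iff matrix_vector_mult_def map_matrix_def)

lemma of_int_vec_eq_iff:
  "of_int_vec x = (of_int_vec y :: 'a::ring_1 ^ 'n) \<longleftrightarrow> (\<forall>i. int CHAR('a) dvd (x - y) $ i)"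
proof -
  have "of_int (x $ i) = (of_int (y $ i) :: 'a) \<longleftrightarrow> int CHAR('a) dvd x $ i - y $ i" for i
    using of_int_eq_0_iff_char_dvd[of "x $ i - y $ i", where 'a = 'a] by simp
  then show ?thesis
    by (simp add: vec_eq_iff)
qed

text \<open>The ring may be infinite, but reductions have entries in its prime subring: every one is
  the reduction of a vector with entries between 0 and the characteristic.\<close>

lemma finite_range_of_int_vec:
  assumes "CHAR('a::ring_1) > 0"
  shows "finite (range (of_int_vec :: int ^ 'n::finite \<Rightarrow> 'a ^ 'n))"
proof -
  let ?p = "int CHAR('a)"
  have "range (of_int_vec :: int ^ 'n \<Rightarrow> 'a ^ 'n) \<subseteq> (\<lambda>f. \<chi> i. of_int (f i)) ` (\<Pi>\<^sub>E i\<in>UNIV. {0..<?p})"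
  proof
    fix y :: "'a ^ 'n" assume "y \<in> range of_int_vec"
    then obtain x where x: "y = of_int_vec x"
      by auto
    have "of_int (x $ i) = (of_int (x $ i mod ?p) :: 'a)" for i
      using of_int_eq_0_iff_char_dvd[of "x $ i - x $ i mod ?p", where 'a = 'a]
      unfolding of_int_diff by (simp add: minus_mod_eq_mult_div del: of_int_diff)
    then have "y = (\<chi> i. of_int ((\<lambda>i. x $ i mod ?p) i))"
      by (simp add: x vec_eq_iff)
    then show "y \<in> (\<lambda>f. \<chi> i. of_int (f i)) ` (\<Pi>\<^sub>E i\<in>UNIV. {0..<?p})"
      using assms by (intro image_eqI[of _ _ "\<lambda>i. x $ i mod ?p"]) auto
  qed
  moreover have "finite ((\<lambda>f. \<chi> i. of_int (f i) :: 'a ^ 'n) ` (\<Pi>\<^sub>E i\<in>UNIV. {0..<?p}))"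
    by (intro finite_imageI finite_PiE) auto
  ultimately show ?thesis
    by (rule finite_subset)
qed

text \<open>Coordinate \<open>i\<close> vanishes on the span of \<open>T\<close> and not at
  \<open>b\<close>, so \<open>b\<close> adds one dimension. This is the pivot step of the two
  eliminations that follow.\<close>

lemma dim_eq_Suc_dim_of_coordinate:
  fixes S T :: "('a::field ^ 'n) set"
  assumes "b \<in> S" "T \<subseteq> S" "S \<subseteq> vec.span (insert b T)"
    and b: "b $ i \<noteq> 0" and T: "\<And>x. x \<in> T \<Longrightarrow> x $ i = 0"
  shows "vec.dim S = Suc (vec.dim T)"
proof -
  have "x $ i = 0" if "x \<in> vec.span T" for x
    using that by (induction rule: vec.span_induct_alt) (auto simp: T)
  then have "b \<notin> vec.span T"
    using b by blast
  then have "vec.dim (insert b T) = Suc (vec.dim T)"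
    by (simp add: vec.dim_insert)
  moreover have "vec.dim S = vec.dim (insert b T)"
    using assms by (intro antisym vec.dim_subset vec.dim_mono) (auto intro: vec.span_base)
  ultimately show ?thesis
    by simp
qed

text \<open>The reduction is a vector space over the prime field, and enlarging the field keeps its
  dimension. The proof is Gaussian elimination: with a pivot \<open>b\<close> that is nonzero modulo
  \<open>p\<close> at coordinate \<open>i\<close>, passing to the vectors of \<open>U\<close>
  divisible by \<open>p\<close> there divides the cardinality by \<open>p\<close> and lowers the
  dimension by one.\<close>

lemma card_of_int_vec_image:
  fixes U :: "(int ^ 'n::finite) set"
  assumes p: "CHAR('a::field) = p" "prime p" and U: "add_subgroup U"
  shows "card (of_int_vec ` U :: ('a ^ 'n) set) = p ^ vec.dim (of_int_vec ` U :: ('a ^ 'n) set)"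
  using U
proof (induction "card {i. \<exists>x\<in>U. \<not> int p dvd x $ i}" arbitrary: U rule: less_induct)
  case less
  let ?g = "of_int_vec :: int ^ 'n \<Rightarrow> 'a ^ 'n"
  have p0: "p > 0"
    using p(2) by (rule prime_gt_0_nat)
  have fin: "finite (?g ` U)" for U
    using finite_range_of_int_vec[where 'a = 'a and 'n = 'n] p p0 by (simp add: finite_subset[OF image_mono[OF subset_UNIV]])
  show ?case
  proof (cases "\<exists>i. \<exists>x\<in>U. \<not> int p dvd x $ i")
    case False
    then have "?g x = 0" if "x \<in> U" for x
      using that of_int_vec_eq_iff[of x 0, where 'a = 'a] by (simp add: p)
    then have "?g ` U = {0}"
      using add_subgroup_zero[OF less.prems] by force
    then show ?thesis
      by simp
  next
    case True
    then obtain i b where b: "b \<in> U" "\<not> int p dvd b $ i"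
      by blast
    define U' where "U' = {x \<in> U. int p dvd x $ i}"
    have U': "add_subgroup U'" "U' \<subseteq> U"
      using less.prems by (auto simp: add_subgroup_def U'_def)
    have sub: "{j. \<exists>x\<in>U'. \<not> int p dvd x $ j} \<subset> {j. \<exists>x\<in>U. \<not> int p dvd x $ j}"
      using b by (auto simp: U'_def)
    then have IH: "card (?g ` U') = p ^ vec.dim (?g ` U')"
      using U'(1) by (intro less.hyps psubset_card_mono) simp_all
    have "coprime (b $ i) (int p)"
      using b p(2) by (metis coprime_commute prime_imp_coprime prime_nat_int_transfer)
    then obtain u v where uv: "b $ i * u + int p * v = 1"
      using bezout_int[of "b $ i" "int p"] by (metis coprime_imp_gcd_eq_1 mult.commute)
    \<comment> \<open>Here \<open>u\<close> inverts the pivot modulo \<open>p\<close>, so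
      \<open>c * u\<close> is the multiple of \<open>b\<close> that clears an entry
      \<open>c\<close>.\<close>
    have res: "int p dvd c - (c * u) * b $ i" for c
    proof -
      have "c - (c * u) * b $ i = c * (b $ i * u + int p * v) - (c * u) * b $ i"
        by (simp add: uv)
      also have "\<dots> = int p * (c * v)"
        by (simp add: algebra_simps)
      finally show ?thesis
        by simp
    qed
    have "card (?g ` U) = card ((\<lambda>x. x $ i mod int p) ` U) * card (?g ` U')"
    proof (rule card_image_add_subgroup[OF less.prems U'])
      show "{x \<in> U. \<forall>j. int p dvd x $ j} \<subseteq> U'"
        by (auto simp: U'_def)
      show "?g x = ?g y \<longleftrightarrow> x - y \<in> {x \<in> U. \<forall>j. int p dvd x $ j}" if "x \<in> U" "y \<in> U" for x y
        using that less.prems by (simp add: of_int_vec_eq_iff p add_subgroup_diff)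
      show "x $ i mod int p = y $ i mod int p \<longleftrightarrow> x - y \<in> U'" if "x \<in> U" "y \<in> U" for x y
        using that less.prems by (simp add: U'_def add_subgroup_diff mod_eq_dvd_iff)
    qed (rule fin)
    moreover have "(\<lambda>x. x $ i mod int p) ` U = {0..<int p}"
    proof (intro equalityI subsetI)
      fix c assume c: "c \<in> {0..<int p}"
      have "(c * u) *s b \<in> U"
        using less.prems b by (simp add: add_subgroup_scale)
      moreover have "c = ((c * u) *s b) $ i mod int p"
        using res[of c] c by (simp flip: mod_eq_dvd_iff)
      ultimately show "c \<in> (\<lambda>x. x $ i mod int p) ` U"
        by blast
    qed (use p0 in auto)
    moreover have "vec.dim (?g ` U) = Suc (vec.dim (?g ` U'))"
    proof (rule dim_eq_Suc_dim_of_coordinate[where b = "?g b" and i = i])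
      show "?g ` U \<subseteq> vec.span (insert (?g b) (?g ` U'))"
      proof clarify
        fix x assume x: "x \<in> U"
        let ?c = "x $ i * u"
        have "x - ?c *s b \<in> U'"
          using x b less.prems res[of "x $ i"] by (simp add: U'_def add_subgroup_diff add_subgroup_scale)
        then have "?g (x - ?c *s b) + of_int ?c *s ?g b \<in> vec.span (insert (?g b) (?g ` U'))"
          by (intro vec.span_add vec.span_scale) (auto intro: vec.span_base)
        then show "?g x \<in> vec.span (insert (?g b) (?g ` U'))"
          by (simp add: of_int_vec_diff of_int_vec_scale)
      qed
      show "?g b $ i \<noteq> 0"
        using b of_int_eq_0_iff_char_dvd[of "b $ i", where 'a = 'a] by (simp add: p)
      show "x $ i = 0" if "x \<in> ?g ` U'" for x
        using that of_int_eq_0_iff_char_dvd[where 'a = 'a] by (auto simp: p U'_def)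
    qed (use b U' in auto)
    ultimately show ?thesis
      using IH by simp
  qed
qed

text \<open>Purity prevents rank from being lost modulo \<open>p\<close>. Elimination now runs over
  the integers: the pivot \<open>m\<close> generates the ideal of \<open>i\<close>-th coordinates,
  and the induction is on the number of coordinates where the lattice is not identically
  zero.\<close>

lemma card_of_int_vec_image_pure:
  fixes V :: "(int ^ 'n::finite) set"
  assumes p: "CHAR('a::field) = p" "prime p" and V: "add_subgroup V"
    and pure: "\<And>x. int p *s x \<in> V \<Longrightarrow> x \<in> V"
  shows "card (of_int_vec ` V :: ('a ^ 'n) set) = p ^ vec.dim (of_int_vec ` V :: (real ^ 'n) set)"
  using V pure
proof (induction "card {i. \<exists>x\<in>V. x $ i \<noteq> 0}" arbitrary: V rule: less_induct)
  case less
  let ?g = "of_int_vec :: int ^ 'n \<Rightarrow> 'a ^ 'n"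
  let ?r = "of_int_vec :: int ^ 'n \<Rightarrow> real ^ 'n"
  have p0: "p > 0"
    using p(2) by (rule prime_gt_0_nat)
  have fin: "finite (?g ` V)" for V
    using finite_range_of_int_vec[where 'a = 'a and 'n = 'n] p p0 by (simp add: finite_subset[OF image_mono[OF subset_UNIV]])
  show ?case
  proof (cases "\<exists>i. \<exists>x\<in>V. x $ i \<noteq> 0")
    case False
    then have "V = {0}"
      using less.prems(1) by (auto simp: vec_eq_iff add_subgroup_zero)
    then show ?thesis
      by simp
  next
    case True
    then obtain i b0 where b0: "b0 \<in> V" "b0 $ i \<noteq> 0"
      by blast
    define m where "m = (LEAST m. 0 < m \<and> (\<exists>x\<in>V. x $ i = int m))"
    \<comment> \<open>Scaling by its own entry makes the \<open>i\<close>-th entry a positive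
      square, so the set minimised by \<open>m\<close> is nonempty.\<close>
    have "(b0 $ i) *s b0 \<in> V"
      using b0 less.prems(1) by (simp add: add_subgroup_scale)
    moreover have pos: "0 < b0 $ i * b0 $ i"
      using b0(2) by (simp add: zero_less_mult_iff linorder_neq_iff disj_commute)
    then have "((b0 $ i) *s b0) $ i = int (nat (b0 $ i * b0 $ i))"
      by simp
    ultimately have "\<exists>m. 0 < m \<and> (\<exists>x\<in>V. x $ i = int m)"
      using pos by (metis zero_less_nat_eq)
    then have "0 < m \<and> (\<exists>x\<in>V. x $ i = int m)"
      unfolding m_def by (rule LeastI_ex)
    then obtain b where m: "0 < m" and b: "b \<in> V" "b $ i = int m"
      by blast
    have dvd: "int m dvd x $ i" if x: "x \<in> V" for x
    proof (rule ccontr)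
      assume "\<not> int m dvd x $ i"
      then have "0 < x $ i mod int m"
        using m by (metis dvd_eq_mod_eq_0 pos_mod_sign order_le_less of_nat_0_less_iff)
      moreover have "x - (x $ i div int m) *s b \<in> V"
        using x b less.prems(1) by (simp add: add_subgroup_diff add_subgroup_scale)
      moreover have "(x - (x $ i div int m) *s b) $ i = int (nat (x $ i mod int m))"
        using m by (simp add: b minus_div_mult_eq_mod)
      ultimately have "0 < nat (x $ i mod int m) \<and> (\<exists>x'\<in>V. x' $ i = int (nat (x $ i mod int m)))"
        by (metis zero_less_nat_eq)
      then have "m \<le> nat (x $ i mod int m)"
        unfolding m_def by (rule Least_le)
      then show False
        using m pos_mod_bound[of "int m" "x $ i"] by linarith
    qed
    \<comment> \<open>\<open>V'\<close> has real rank one less than \<open>V\<close>, while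
      \<open>W\<close> has index \<open>p\<close> in \<open>V\<close>. The two have the same
      reduction modulo \<open>p\<close>, which couples the count with the real dimension.\<close>
    define V' where "V' = {x \<in> V. x $ i = 0}"
    define W where "W = {x \<in> V. int p * int m dvd x $ i}"
    have V': "add_subgroup V'" "V' \<subseteq> V" and W: "add_subgroup W" "W \<subseteq> V"
      using less.prems(1) by (auto simp: add_subgroup_def V'_def W_def)
    have V'pure: "x \<in> V'" if "int p *s x \<in> V'" for x
      using that less.prems(2)[of x] p0 by (simp add: V'_def)
    have sub: "{j. \<exists>x\<in>V'. x $ j \<noteq> 0} \<subset> {j. \<exists>x\<in>V. x $ j \<noteq> 0}"
      using b m by (force simp: V'_def)
    then have IH: "card (?g ` V') = p ^ vec.dim (?r ` V')"
      using V'(1) V'pure by (intro less.hyps psubset_card_mono) simp_all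
    have "card (?g ` V) = card ((\<lambda>x. (x $ i div int m) mod int p) ` V) * card (?g ` W)"
    proof (rule card_image_add_subgroup[OF less.prems(1) W])
      \<comment> \<open>Purity enters here: a vector of \<open>V\<close> divisible by
        \<open>p\<close> is \<open>p\<close> times a vector of \<open>V\<close>, whose
        \<open>i\<close>-th coordinate is divisible by \<open>m\<close>.\<close>
      show "{x \<in> V. \<forall>j. int p dvd x $ j} \<subseteq> W"
      proof clarify
        fix x assume x: "x \<in> V" "\<forall>j. int p dvd x $ j"
        then have "x = int p *s (\<chi> j. x $ j div int p)"
          by (simp add: vec_eq_iff)
        moreover from this have "(\<chi> j. x $ j div int p) \<in> V"
          using x less.prems(2) by metis
        ultimately show "x \<in> W"
          using dvd[of "\<chi> j. x $ j div int p"] x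
          by (simp add: W_def) (metis dvd_mult_div_cancel mult_dvd_mono dvd_refl)
      qed
      show "?g x = ?g y \<longleftrightarrow> x - y \<in> {x \<in> V. \<forall>j. int p dvd x $ j}" if "x \<in> V" "y \<in> V" for x y
        using that less.prems(1) by (simp add: of_int_vec_eq_iff p add_subgroup_diff)
      show "x $ i div int m mod int p = y $ i div int m mod int p \<longleftrightarrow> x - y \<in> W"
        if xy: "x \<in> V" "y \<in> V" for x y
      proof -
        have "int p dvd x $ i div int m - y $ i div int m \<longleftrightarrow> int p * int m dvd x $ i - y $ i"
          using dvd[OF xy(1)] dvd[OF xy(2)] m by (auto elim!: dvdE simp flip: right_diff_distrib)
        then show ?thesis
          using xy less.prems(1) by (simp add: W_def add_subgroup_diff mod_eq_dvd_iff)
      qed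
    qed (rule fin)
    moreover have "(\<lambda>x. (x $ i div int m) mod int p) ` V = {0..<int p}"
    proof (intro equalityI subsetI)
      fix c assume c: "c \<in> {0..<int p}"
      have "c *s b \<in> V"
        using less.prems(1) b by (simp add: add_subgroup_scale)
      moreover have "c = ((c *s b) $ i div int m) mod int p"
        using c m by (simp add: b)
      ultimately show "c \<in> (\<lambda>x. (x $ i div int m) mod int p) ` V"
        by blast
    qed (use p0 in auto)
    \<comment> \<open>An element of \<open>W\<close> is moved into \<open>V'\<close> by subtracting
      a multiple of \<open>b\<close> whose coefficient is divisible by \<open>p\<close>; this does
      not change the reduction.\<close>
    moreover have "?g ` W = ?g ` V'"
    proof (intro equalityI subsetI)
      fix y assume "y \<in> ?g ` W"
      then obtain x where x: "x \<in> V" "int p * int m dvd x $ i" "y = ?g x"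
        by (auto simp: W_def)
      then obtain c where c: "x $ i = int p * int m * c"
        by auto
      have "x - (int p * c) *s b \<in> V'"
        using x b c less.prems(1) by (simp add: V'_def add_subgroup_diff add_subgroup_scale)
      moreover have "?g (x - (int p * c) *s b) = y"
        unfolding x(3) of_int_vec_eq_iff by (simp add: p)
      ultimately show "y \<in> ?g ` V'"
        by blast
    qed (auto simp: V'_def W_def)
    moreover have "vec.dim (?r ` V) = Suc (vec.dim (?r ` V'))"
    proof (rule dim_eq_Suc_dim_of_coordinate[where b = "?r b" and i = i])
      show "?r ` V \<subseteq> vec.span (insert (?r b) (?r ` V'))"
      proof clarify
        fix x assume x: "x \<in> V"
        let ?c = "x $ i div int m"
        have "x - ?c *s b \<in> V'"
          using x b less.prems(1) dvd[OF x] by (simp add: V'_def add_subgroup_diff add_subgroup_scale)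
        then have "?r (x - ?c *s b) + of_int ?c *s ?r b \<in> vec.span (insert (?r b) (?r ` V'))"
          by (intro vec.span_add vec.span_scale) (auto intro: vec.span_base)
        then show "?r x \<in> vec.span (insert (?r b) (?r ` V'))"
          by (simp add: of_int_vec_diff of_int_vec_scale)
      qed
    qed (use b m V' in \<open>auto simp: V'_def\<close>)
    ultimately show ?thesis
      using IH by simp
  qed
qed

section \<open>Linear algebra over a field\<close>

text \<open>Over a general field nonzero vectors may be orthogonal to themselves, so no orthogonal
  basis is used. A basis \<open>B\<close> of the span of \<open>S\<close> is extended to the whole
  space; the matrix \<open>P\<close> with these rows is injective and sends \<open>T\<close> to
  vectors vanishing at the coordinates belonging to \<open>B\<close>.\<close>

lemma dim_orthogonal_le:
  fixes S T :: "('a::field ^ 'n::finite) set"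
  assumes orth: "\<And>s t. s \<in> S \<Longrightarrow> t \<in> T \<Longrightarrow> (\<Sum>i\<in>UNIV. s $ i * t $ i) = 0"
  shows "vec.dim S + vec.dim T \<le> CARD('n)"
proof -
  obtain B where B: "B \<subseteq> S" "vec.independent B" "S \<subseteq> vec.span B" "card B = vec.dim S"
    using vec.basis_exists[of S] by blast
  define C where "C = vec.extend_basis B"
  have C: "B \<subseteq> C" "vec.independent C" "vec.span C = UNIV"
    using B(2) by (simp_all add: C_def vec.extend_basis_superset vec.independent_extend_basis vec.span_extend_basis)
  have finC: "finite C"
    using C(2) by (rule vec.finiteI_independent)
  have "card C = CARD('n)"
    using vec.dim_eq_card_independent[OF C(2)] vec.dim_span[of C] C(3) by (simp add: card_cart_basis)
  then obtain h :: "'n \<Rightarrow> 'a ^ 'n" where h: "bij_betw h UNIV C"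
    using finC by (metis finite bij_betw_iff_card)
  define P :: "'a ^ 'n ^ 'n" where "P = (\<chi> i. h i)"
  have P: "(P *v x) $ i = (\<Sum>j\<in>UNIV. h i $ j * x $ j)" for x i
    by (simp add: P_def matrix_vector_mult_def)
  have "x = 0" if x: "P *v x = 0" for x
  proof -
    \<comment> \<open>A vector killed by \<open>P\<close> pairs to zero with every row, hence with
      the whole space, in particular with the unit vectors.\<close>
    have "(\<Sum>j\<in>UNIV. c $ j * x $ j) = 0" if "c \<in> vec.span C" for c
      using that
    proof (induction rule: vec.span_induct_alt)
      case (step a c y)
      then obtain i where "c = h i"
        using h by (auto simp: bij_betw_def)
      then show ?case
        using step P[of x i] x by (simp add: algebra_simps sum.distrib flip: sum_distrib_left)
    qed simp
    then have "(\<Sum>j\<in>UNIV. axis k 1 $ j * x $ j) = 0" for k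
      by (simp add: C(3))
    then show "x = 0"
      by (simp add: vec_eq_iff axis_def if_distrib[of "\<lambda>a. a * _"] cong: if_cong)
  qed
  then have "x - y = 0" if "P *v x = P *v y" for x y
    using that by (metis matrix_vector_mult_diff_distrib right_minus_eq)
  then have "inj ((*v) P)"
    by (auto intro: injI)
  then have "vec.dim ((*v) P ` T) = vec.dim T"
    by (intro vec.dim_image_eq) (auto intro: inj_on_subset)
  moreover have "vec.dim ((*v) P ` T) \<le> card ((\<lambda>i. axis i 1 :: 'a ^ 'n) ` {i. h i \<notin> B})"
  proof (rule vec.dim_le_card)
    show "(*v) P ` T \<subseteq> vec.span ((\<lambda>i. axis i 1) ` {i. h i \<notin> B})"
    proof clarify
      fix t assume t: "t \<in> T"
      have "(P *v t) $ i = 0" if "h i \<in> B" for i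
        using orth[of "h i" t] that B(1) t by (auto simp: P)
      then have "P *v t = (\<Sum>i | h i \<notin> B. (P *v t) $ i *s axis i 1)"
        by (auto simp: vec_eq_iff axis_def if_distrib[of "\<lambda>a. _ * a"] sum.delta cong: if_cong)
      also have "\<dots> \<in> vec.span ((\<lambda>i. axis i 1) ` {i. h i \<notin> B})"
        by (intro vec.span_sum vec.span_scale vec.span_base) auto
      finally show "P *v t \<in> vec.span ((\<lambda>i. axis i 1) ` {i. h i \<notin> B})" .
    qed
  qed simp
  moreover have "card ((\<lambda>i. axis i 1 :: 'a ^ 'n) ` {i. h i \<notin> B}) \<le> card {i. h i \<notin> B}"
    by (rule card_image_le) simp
  moreover have "card {i. h i \<notin> B} = CARD('n) - card B"
  proof -
    have "card {i. h i \<in> B} = card B"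
      using bij_betw_same_card[OF bij_betw_subset[OF h, of "{i. h i \<in> B}" B]] h C(1)
      by (auto simp: bij_betw_def)
    moreover have "{i. h i \<notin> B} = - {i. h i \<in> B}"
      by auto
    ultimately show ?thesis
      by (simp add: Compl_eq_Diff_UNIV card_Diff_subset)
  qed
  moreover have "card B \<le> CARD('n)"
    using card_mono[OF finC C(1)] \<open>card C = CARD('n)\<close> by simp
  ultimately show ?thesis
    using B(4) by simp
qed

text \<open>The matrix is \<open>c\<close> times the orthogonal projection onto its range, and a
  projection has trace equal to its rank.\<close>

lemma dim_range_eq_trace:
  fixes X :: "real ^ 'n ^ 'n"
  assumes sym: "transpose X = X" and idem: "X ** X = c *\<^sub>R X" and c: "c \<noteq> 0"
  shows "c * real (vec.dim (range ((*v) X))) = trace X"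
proof -
  let ?S = "range ((*v) X)"
  have "subspace ?S"
    by (metis linear_subspace_image matrix_vector_mul_linear subspace_UNIV)
  then obtain B where B: "B \<subseteq> ?S" "pairwise orthogonal B" "\<And>x. x \<in> B \<Longrightarrow> norm x = 1"
    "independent B" "card B = dim ?S" "span B = ?S"
    using orthonormal_basis_subspace by blast
  have finB: "finite B"
    using B(4) by (rule independent_imp_finite)
  have adj: "(X *v x) \<bullet> y = x \<bullet> (X *v y)" for x y
    by (metis dot_lmul_matrix sym vector_transpose_matrix)
  have eig: "X *v b = c *\<^sub>R b" if "b \<in> B" for b
  proof -
    obtain y where "b = X *v y"
      using B(1) \<open>b \<in> B\<close> by blast
    then have "X *v b = (X ** X) *v y"
      by (simp add: matrix_vector_mul_assoc)
    then show ?thesis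
      by (simp add: idem \<open>b = X *v y\<close> scaleR_matrix_vector_assoc)
  qed
  have expand: "X *v x = (\<Sum>b\<in>B. ((X *v x) \<bullet> b) *\<^sub>R b)" for x
    using orthonormal_basis_expand[of B "X *v x"] B finB by auto
  \<comment> \<open>The diagonal entries are expanded in the orthonormal basis \<open>B\<close> of
    the range. After exchanging the sums each \<open>b\<close> contributes \<open>c\<close> times
    its squared norm, which is \<open>c\<close>.\<close>
  have "trace X = (\<Sum>i\<in>UNIV. (X *v axis i 1) \<bullet> axis i 1)"
    by (simp add: trace_def matrix_vector_mult_basis column_def inner_axis)
  also have "\<dots> = (\<Sum>i\<in>UNIV. \<Sum>b\<in>B. c * (axis i 1 \<bullet> b)\<^sup>2)"
  proof (rule sum.cong[OF refl])
    fix i :: 'n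
    have "(X *v axis i 1) \<bullet> axis i 1 = (\<Sum>b\<in>B. ((X *v axis i 1) \<bullet> b) * (b \<bullet> axis i 1))"
      by (subst expand) (simp add: inner_sum_left)
    also have "\<dots> = (\<Sum>b\<in>B. c * (axis i 1 \<bullet> b)\<^sup>2)"
    proof (rule sum.cong[OF refl])
      fix b assume "b \<in> B"
      then have "(X *v axis i 1) \<bullet> b = c * (axis i 1 \<bullet> b)"
        by (simp add: adj eig)
      then show "((X *v axis i 1) \<bullet> b) * (b \<bullet> axis i 1) = c * (axis i 1 \<bullet> b)\<^sup>2"
        by (simp only: inner_commute[of b] power2_eq_square mult.assoc)
    qed
    finally show "(X *v axis i 1) \<bullet> axis i 1 = (\<Sum>b\<in>B. c * (axis i 1 \<bullet> b)\<^sup>2)" .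
  qed
  also have "\<dots> = (\<Sum>b\<in>B. \<Sum>i\<in>UNIV. c * (axis i 1 \<bullet> b)\<^sup>2)"
    by (rule sum.swap)
  also have "\<dots> = (\<Sum>b\<in>B. c * (b \<bullet> b))"
    unfolding sum_distrib_left[symmetric] inner_axis' by (simp add: inner_vec_def power2_eq_square)
  also have "\<dots> = (\<Sum>b\<in>B. c)"
    using B(3) by (intro sum.cong) (auto simp: norm_eq_1)
  finally show ?thesis
    using B(5) by (simp add: dim_vec_eq)
qed

text \<open>\<open>rank\<close> unfolds to the dimension spanned by the rows; symmetry turns rows
  into columns, which span the range.\<close>

lemma rank_symmetric:
  fixes A :: "'a::field ^ 'n ^ 'n"
  assumes "transpose A = A"
  shows "rank A = vec.dim (range ((*v) A))"
proof -
  have "columns A \<subseteq> range ((*v) A)"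
  proof
    fix x assume "x \<in> columns A"
    then obtain i where "x = column i A"
      by (auto simp: columns_def)
    also have "\<dots> = A *v axis i 1"
      by (simp add: vec_eq_iff column_def matrix_vector_mult_def axis_def if_distrib[of "\<lambda>a. _ * a"] cong: if_cong)
    finally show "x \<in> range ((*v) A)"
      by blast
  qed
  then have "vec.dim (columns A) = vec.dim (range ((*v) A))"
    by (intro antisym vec.dim_subset vec.dim_mono) (auto intro: matrix_vector_mult_in_columnspace_gen)
  then show ?thesis
    unfolding row_rank_def_gen using assms by (metis columns_transpose)
qed

lemma matrix_vector_mult_axis:
  fixes A :: "'a::comm_ring_1 ^ 'n ^ 'm"
  shows "A *v axis j 1 = column j A"
  by (simp add: vec_eq_iff column_def matrix_vector_mult_def axis_def if_distrib[of "\<lambda>a. _ * a"] cong: if_cong)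

lemma matrix_vector_mult_scale:
  fixes A :: "'a::comm_ring_1 ^ 'n ^ 'm"
  shows "A *v (c *s x) = c *s (A *v x)"
  by (simp add: vec_eq_iff matrix_vector_mult_def sum_distrib_left ac_simps)

lemma sum_mult_axis:
  fixes x :: "'a::comm_ring_1 ^ 'n"
  shows "(\<Sum>i\<in>UNIV. axis j 1 $ i * x $ i) = x $ j"
  by (simp add: axis_def if_distrib[of "\<lambda>a. a * _"] cong: if_cong)

lemma sum_axis: "(\<Sum>i\<in>UNIV. axis j 1 $ i) = (1 :: 'a::comm_ring_1)"
  by (simp add: axis_def)

lemma range_of_int_matrix_subset_span:
  fixes A :: "int ^ 'n ^ 'm"
  shows "range ((*v) (map_matrix of_int A :: 'a::field ^ 'n ^ 'm))
    \<subseteq> vec.span (of_int_vec ` range ((*v) A))"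
proof clarify
  fix x :: "'a ^ 'n"
  have "map_matrix of_int A *v x = (\<Sum>i\<in>UNIV. x $ i *s (of_int_vec (A *v axis i 1) :: 'a ^ 'm))"
    unfolding matrix_vector_mult_axis by (simp add: matrix_mult_sum vec_eq_iff column_def map_matrix_def)
  also have "\<dots> \<in> vec.span (of_int_vec ` range ((*v) A))"
    by (intro vec.span_sum vec.span_scale vec.span_base) auto
  finally show "map_matrix of_int A *v x \<in> vec.span (of_int_vec ` range ((*v) A))" .
qed

text \<open>This links a range over the field to the reduction of an integer lattice, where counting
  applies. The columns lie in both sets and span the first.\<close>

lemma dim_range_of_int_matrix:
  fixes A :: "int ^ 'n ^ 'm"
  shows "vec.dim (range ((*v) (map_matrix of_int A :: 'a::field ^ 'n ^ 'm)))
    = vec.dim (of_int_vec ` range ((*v) A) :: ('a ^ 'm) set)"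
proof (rule antisym)
  show "vec.dim (of_int_vec ` range ((*v) A) :: ('a ^ 'm) set)
      \<le> vec.dim (range ((*v) (map_matrix of_int A :: 'a ^ 'n ^ 'm)))"
    by (intro vec.dim_subset) (auto simp: of_int_vec_mult)
qed (intro vec.dim_mono range_of_int_matrix_subset_span)

section \<open>The Laplacian of a Moore graph of valency 57\<close>

lemma numeral_eq_0_char_5:
  assumes "CHAR('k::field) = 5"
  shows "(115 :: 'k) = 0" "(3250 :: 'k) = 0"
  using of_nat_eq_0_iff_char_dvd[of 115, where 'a = 'k] of_nat_eq_0_iff_char_dvd[of 3250, where 'a = 'k]
  by (simp_all add: assms)

lemma carrier_int_vec_group [simp]: "carrier int_vec_group = UNIV"
  and mult_int_vec_group [simp]: "x \<otimes>\<^bsub>int_vec_group\<^esub> y = x + y"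
  and one_int_vec_group [simp]: "\<one>\<^bsub>int_vec_group\<^esub> = 0"
  by (simp_all add: int_vec_group_def)

lemma comm_group_int_vec_group: "comm_group int_vec_group"
proof (rule comm_groupI)
  fix x :: "int ^ 'a"
  show "\<exists>y\<in>carrier int_vec_group. y \<otimes>\<^bsub>int_vec_group\<^esub> x = \<one>\<^bsub>int_vec_group\<^esub>"
    by (auto intro: exI[of _ "- x"])
qed (auto simp: ac_simps)

lemma inv_int_vec_group: "inv\<^bsub>int_vec_group\<^esub> x = - x"
  using comm_group_int_vec_group
  by (intro group.inv_equality) (auto simp: comm_group_def)

lemma pow_int_vec_group: "x [^]\<^bsub>int_vec_group\<^esub> (n::nat) = int n *s x"
  by (induction n) (auto simp: nat_pow_def vec_eq_iff algebra_simps)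

text \<open>All that the algebra uses about the graph. \<open>square\<close> is the entrywise form
  of L^2 = 115 L - 3250 I + J, where J is the all-ones matrix and t^2 - 115 t + 3250 = (t - 50)(t -
  65).\<close>

locale moore_laplacian =
  fixes L :: "int ^ 'v ^ 'v::finite"
  assumes symL: "L $ i $ j = L $ j $ i"
    and row_sum: "(\<Sum>j\<in>UNIV. L $ i $ j) = 0"
    and square: "(\<Sum>k\<in>UNIV. L $ i $ k * L $ k $ j) = 115 * L $ i $ j - (if i = j then 3250 else 0) + 1"
    and diag: "L $ i $ i = 57"
    and card_V: "CARD('v) = 3250"
begin

text \<open>Being polymorphic, identities for this matrix are proved once over commutative rings and
  specialised to the integers through \<open>LR_int\<close>.\<close>

abbreviation LR :: "'a::comm_ring_1 ^ 'v ^ 'v" where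
  "LR \<equiv> map_matrix of_int L"

lemma LR_int: "LR = L"
  by (simp add: vec_eq_iff map_matrix_def)

lemma LR_square:
  fixes x :: "'a::comm_ring_1 ^ 'v"
  shows "LR *v (LR *v x) = 115 *s (LR *v x) - 3250 *s x + vec (\<Sum>i\<in>UNIV. x $ i)"
proof -
  have "(LR *v (LR *v x)) $ i = (115 *s (LR *v x) - 3250 *s x + vec (\<Sum>i\<in>UNIV. x $ i)) $ i" for i
  proof -
    have "(LR *v (LR *v x)) $ i = (\<Sum>k\<in>UNIV. \<Sum>j\<in>UNIV. of_int (L $ i $ k * L $ k $ j) * x $ j)"
      by (simp add: matrix_vector_mult_def map_matrix_def sum_distrib_left mult.assoc)
    also have "\<dots> = (\<Sum>j\<in>UNIV. of_int (\<Sum>k\<in>UNIV. L $ i $ k * L $ k $ j) * x $ j)"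
      by (subst sum.swap) (simp add: sum_distrib_right)
    also have "\<dots> = (\<Sum>j\<in>UNIV. 115 * (of_int (L $ i $ j) * x $ j) - (if i = j then 3250 * x $ j else 0) + x $ j)"
      unfolding square by (rule sum.cong) (auto simp: algebra_simps)
    also have "\<dots> = 115 * (\<Sum>j\<in>UNIV. of_int (L $ i $ j) * x $ j) - 3250 * x $ i + (\<Sum>j\<in>UNIV. x $ j)"
      by (simp add: sum.distrib sum_subtractf sum_distrib_left)
    finally show ?thesis
      by (simp add: matrix_vector_mult_def map_matrix_def)
  qed
  then show ?thesis
    unfolding vec_eq_iff by blast
qed

lemmas L_square = LR_square[where 'a = int, unfolded LR_int]

lemma LR_adjoint:
  fixes x y :: "'a::comm_ring_1 ^ 'v"
  shows "(\<Sum>i\<in>UNIV. (LR *v x) $ i * y $ i) = (\<Sum>i\<in>UNIV. x $ i * (LR *v y) $ i)"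
proof -
  have "(\<Sum>i\<in>UNIV. (LR *v x) $ i * y $ i) = (\<Sum>i\<in>UNIV. \<Sum>j\<in>UNIV. of_int (L $ i $ j) * x $ j * y $ i)"
    by (simp add: matrix_vector_mult_def map_matrix_def sum_distrib_right)
  also have "\<dots> = (\<Sum>j\<in>UNIV. \<Sum>i\<in>UNIV. of_int (L $ j $ i) * x $ j * y $ i)"
    by (subst sum.swap) (simp add: symL)
  also have "\<dots> = (\<Sum>i\<in>UNIV. x $ i * (LR *v y) $ i)"
    by (simp add: matrix_vector_mult_def map_matrix_def sum_distrib_left ac_simps)
  finally show ?thesis .
qed

lemmas L_adjoint = LR_adjoint[where 'a = int, unfolded LR_int]

lemma LR_vec: "LR *v vec c = (0 :: 'a::comm_ring_1 ^ 'v)"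
proof -
  have "(\<Sum>j\<in>UNIV. of_int (L $ i $ j)) = (0 :: 'a)" for i
    using row_sum[of i] by (metis of_int_0 of_int_sum)
  then show ?thesis
    by (simp add: vec_eq_iff matrix_vector_mult_def map_matrix_def flip: sum_distrib_right)
qed

lemmas L_vec = LR_vec[where 'a = int, unfolded LR_int]

lemma sum_LR: "(\<Sum>i\<in>UNIV. (LR *v x) $ i) = (0 :: 'a::comm_ring_1)"
  using LR_adjoint[of x "vec 1"] unfolding LR_vec by simp

lemmas sum_L = sum_LR[where 'a = int, unfolded LR_int]

text \<open>On the kernel the square identity leaves 3250 times each entry equal to the sum of all
  entries, so the entries agree.\<close>

lemma L_eq_0_iff: "L *v x = 0 \<longleftrightarrow> (\<exists>c. x = vec c)"
proof
  assume Lx: "L *v x = 0"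
  have "3250 * x $ i = (\<Sum>i\<in>UNIV. x $ i)" for i
    using arg_cong[OF L_square[of x], of "\<lambda>y. y $ i"] by (simp add: Lx)
  then have "x $ i = x $ j" for i j
    by (metis mult_cancel_left zero_neq_numeral)
  then show "\<exists>c. x = vec c"
    by (intro exI[of _ "x $ undefined"]) (simp add: vec_eq_iff)
qed (auto simp: L_vec)

lemma transpose_LR: "transpose LR = LR"
  by (simp add: vec_eq_iff transpose_def map_matrix_def symL)

section \<open>Integral eigenvectors of the Laplacian\<close>

definition eigenlattice :: "int \<Rightarrow> (int ^ 'v) set" where
  "eigenlattice a = {x. L *v x = a *s x}"

lemma add_subgroup_eigenlattice: "add_subgroup (eigenlattice a)"
  by (simp add: add_subgroup_def eigenlattice_def matrix_vector_mult_diff_distrib vector_ssub_ldistrib)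

lemma eigenlattice_pure:
  assumes "c *s x \<in> eigenlattice a" "c \<noteq> 0"
  shows "x \<in> eigenlattice a"
proof -
  have "c *s (L *v x) = c *s (a *s x)"
    using assms by (simp add: eigenlattice_def matrix_vector_mult_scale vector_smult_assoc mult.commute)
  then show ?thesis
    using assms(2) by (simp add: eigenlattice_def vec_eq_iff)
qed

text \<open>\<open>3250 I - a L - J\<close> is a multiple of the orthogonal projection onto the \<open>a\<close>-eigenspace of \<open>L\<close>,
  so the multiplicity of \<open>a\<close> can be read off its trace.\<close>

lemma dim_eigenlattice:
  assumes a: "a * a - 115 * a + 3250 = 0" and c: "3250 - a * a \<noteq> 0"
    and d: "(3250 - a * a) * int d = 3250 * (3249 - 57 * a)"
  shows "d \<le> vec.dim (of_int_vec ` eigenlattice a :: (real ^ 'v) set)"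
proof -
  \<comment> \<open>The other root b of the quadratic satisfies a b = 3250, so \<open>X\<close>
    kills the b-eigenvectors and the constants and acts as 3250 - a^2 on the a-eigenvectors.\<close>
  define X :: "int ^ 'v ^ 'v" where
    "X = (\<chi> i j. (if i = j then 3250 else 0) - a * L $ i $ j - 1)"
  have X: "X *v x = 3250 *s x - a *s (L *v x) - vec (\<Sum>i\<in>UNIV. x $ i)" for x
    by (simp add: X_def vec_eq_iff matrix_vector_mult_def left_diff_distrib sum_subtractf sum_distrib_left
        mult.assoc if_distrib[of "\<lambda>a. a * _"] cong: if_cong)
  have eig: "L *v (X *v x) = a *s (X *v x)" for x
  proof -
    have "L *v (X *v x) = 3250 *s (L *v x) - a *s (L *v (L *v x))"
      by (simp add: X matrix_vector_mult_diff_distrib matrix_vector_mult_scale L_vec)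
    also have "\<dots> = a *s (X *v x)"
    proof -
      have "3250 * (L *v x) $ i - a * (115 * (L *v x) $ i - 3250 * x $ i + s) =
          a * (3250 * x $ i - a * (L *v x) $ i - s)" for i s
      proof -
        have "(3250 - 115 * a + a * a) * (L *v x) $ i = 0"
          using a by simp
        then show ?thesis
          by (simp add: algebra_simps)
      qed
      then show ?thesis
        by (simp add: X L_square vec_eq_iff)
    qed
    finally show ?thesis .
  qed
  have "(\<Sum>i\<in>UNIV. (X *v x) $ i) = 0" for x
    using sum_L[of x] by (simp add: X sum_subtractf card_V flip: sum_distrib_left)
  then have "X *v (X *v x) = (3250 - a * a) *s (X *v x)" for x
    unfolding X[of "X *v x"] eig by (simp add: vec_eq_iff algebra_simps)
  then have XX: "X ** X = (\<chi> i j. (3250 - a * a) * X $ i $ j)"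
    by (simp add: matrix_eq matrix_vector_mul_assoc[symmetric])
      (simp add: vec_eq_iff matrix_vector_mult_def sum_distrib_left mult.assoc)
  let ?X = "map_matrix real_of_int X"
  have "transpose ?X = ?X"
    by (auto simp: X_def vec_eq_iff transpose_def map_matrix_def symL)
  moreover have "?X ** ?X = of_int (3250 - a * a) *\<^sub>R ?X"
  proof -
    have "(\<Sum>k\<in>UNIV. X $ i $ k * X $ k $ j) = (3250 - a * a) * X $ i $ j" for i j
      using arg_cong[OF XX, of "\<lambda>Z. Z $ i $ j"] by (simp add: matrix_matrix_mult_def)
    then have "real_of_int (\<Sum>k\<in>UNIV. X $ i $ k * X $ k $ j) = real_of_int ((3250 - a * a) * X $ i $ j)" for i j
      by simp
    then show ?thesis
      by (simp add: vec_eq_iff matrix_matrix_mult_def map_matrix_def)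
  qed
  ultimately have "of_int (3250 - a * a) * real (vec.dim (range ((*v) ?X))) = trace ?X"
    using c by (intro dim_range_eq_trace) linarith+
  moreover have "trace ?X = of_int (3250 * (3249 - 57 * a))"
    by (simp add: trace_def map_matrix_def X_def diag card_V)
  ultimately have "real_of_int ((3250 - a * a) * int (vec.dim (range ((*v) ?X)))) = of_int (3250 * (3249 - 57 * a))"
    by (simp only: of_int_mult of_int_of_nat_eq)
  then have "(3250 - a * a) * int (vec.dim (range ((*v) ?X))) = (3250 - a * a) * int d"
    unfolding d of_int_eq_iff .
  then have "d = vec.dim (range ((*v) ?X))"
    using c by simp
  also have "\<dots> \<le> vec.dim (of_int_vec ` eigenlattice a :: (real ^ 'v) set)"
    unfolding dim_range_of_int_matrix by (intro vec.dim_subset image_mono) (auto simp: eigenlattice_def eig)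
  finally show ?thesis .
qed

section \<open>Dimensions modulo 5 of the lattices \<open>div_lattice j\<close>\<close>

definition div_lattice :: "nat \<Rightarrow> (int ^ 'v) set" where
  "div_lattice j = {x. \<forall>i. 5 ^ j dvd (L *v x) $ i}"

lemma add_subgroup_div_lattice: "add_subgroup (div_lattice j)"
  by (simp add: add_subgroup_def div_lattice_def matrix_vector_mult_diff_distrib)

lemma add_subgroup_range_L: "add_subgroup (range ((*v) L))"
  unfolding add_subgroup_def
proof (intro conjI ballI)
  show "0 \<in> range ((*v) L)"
    by (rule range_eqI[of _ _ 0]) simp
  show "x - y \<in> range ((*v) L)" if "x \<in> range ((*v) L)" "y \<in> range ((*v) L)" for x y
    using that by (auto simp flip: matrix_vector_mult_diff_distrib)
qed

text \<open>Rank-nullity obtained by counting: the fibres of reducing \<open>L *v x\<close> modulo 5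
  are the cosets of \<open>div_lattice 1\<close>, so the 5^3250 residue vectors factor as the
  reduced image times the reduced kernel.\<close>

lemma dim_div_lattice_1:
  assumes char: "CHAR('k::field) = 5"
  shows "rank (LR :: 'k ^ 'v ^ 'v) + vec.dim (of_int_vec ` div_lattice 1 :: ('k ^ 'v) set) = 3250"
proof -
  let ?g = "of_int_vec :: int ^ 'v \<Rightarrow> 'k ^ 'v"
  have p5: "prime (5::nat)"
    by simp
  note card_eq = card_of_int_vec_image[OF char p5]
  have "vec.dim (range ?g) = 3250"
  proof -
    have "x \<in> vec.span (range ?g)" for x
    proof -
      have "x = (\<Sum>i\<in>UNIV. x $ i *s ?g (axis i 1))"
        by (simp add: vec_eq_iff axis_def if_distrib[of "\<lambda>a. _ * a"] if_distrib[of of_int] cong: if_cong)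
      also have "\<dots> \<in> vec.span (range ?g)"
        by (intro vec.span_sum vec.span_scale vec.span_base) auto
      finally show ?thesis .
    qed
    then have "vec.dim (range ?g) = vec.dim (UNIV :: ('k ^ 'v) set)"
      by (intro antisym vec.dim_mono) auto
    then show ?thesis
      by (simp only: vec_dim_card card_V)
  qed
  moreover have "card (range ?g) = card ((\<lambda>x. ?g (L *v x)) ` UNIV) * card (?g ` div_lattice 1)"
  proof (rule card_image_add_subgroup[OF add_subgroup_UNIV add_subgroup_div_lattice])
    show "{x. \<forall>i. 5 dvd x $ i} \<subseteq> div_lattice 1"
      by (auto simp: div_lattice_def matrix_vector_mult_def intro: dvd_sum)
    show "?g (L *v x) = ?g (L *v y) \<longleftrightarrow> x - y \<in> div_lattice 1" for x y
      by (simp add: of_int_vec_eq_iff char div_lattice_def matrix_vector_mult_diff_distrib)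
    show "?g x = ?g y \<longleftrightarrow> x - y \<in> {x. \<forall>i. 5 dvd x $ i}" for x y
      by (simp add: of_int_vec_eq_iff char)
    show "finite (range ?g)"
      by (rule finite_range_of_int_vec) (simp add: char)
  qed simp
  moreover have "card ((\<lambda>x. ?g (L *v x)) ` UNIV) = 5 ^ rank (LR :: 'k ^ 'v ^ 'v)"
    using card_eq[OF add_subgroup_range_L]
    by (simp add: rank_symmetric[OF transpose_LR] dim_range_of_int_matrix image_image)
  moreover have "(5::nat) ^ vec.dim (range ?g) = card (range ?g)"
    by (rule card_eq[OF add_subgroup_UNIV, symmetric])
  ultimately have "(5::nat) ^ 3250 = 5 ^ (rank (LR :: 'k ^ 'v ^ 'v) + vec.dim (?g ` div_lattice 1))"
    using card_eq[OF add_subgroup_div_lattice, of 1] by (simp only: power_add)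
  then show ?thesis
    by (subst (asm) power_inject_exp) simp_all
qed

text \<open>Eigenlattices are pure, so their dimension modulo 5 equals the real one, which the trace
  bounds below.\<close>

lemma dim_eigenlattice_char_5:
  assumes char: "CHAR('k::field) = 5"
  shows "1729 \<le> vec.dim (of_int_vec ` eigenlattice 50 :: ('k ^ 'v) set)"
    and "1520 \<le> vec.dim (of_int_vec ` eigenlattice 65 :: ('k ^ 'v) set)"
proof -
  have p5: "prime (5::nat)"
    by simp
  have "vec.dim (of_int_vec ` eigenlattice a :: ('k ^ 'v) set) = vec.dim (of_int_vec ` eigenlattice a :: (real ^ 'v) set)" for a
  proof -
    have "(5::nat) ^ vec.dim (of_int_vec ` eigenlattice a :: ('k ^ 'v) set)
        = 5 ^ vec.dim (of_int_vec ` eigenlattice a :: (real ^ 'v) set)"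
      using card_of_int_vec_image[OF char p5 add_subgroup_eigenlattice, of a]
        card_of_int_vec_image_pure[OF char p5 add_subgroup_eigenlattice, of a] eigenlattice_pure[of 5 _ a]
      by simp
    then show ?thesis
      by (rule power_inject_exp[THEN iffD1, rotated]) simp
  qed
  \<comment> \<open>The trace formula gives 3250 * 399 / 750 = 1729 for the eigenvalue 50 and 3250 *
    456 / 975 = 1520 for 65.\<close>
  then show "1729 \<le> vec.dim (of_int_vec ` eigenlattice 50 :: ('k ^ 'v) set)"
    "1520 \<le> vec.dim (of_int_vec ` eigenlattice 65 :: ('k ^ 'v) set)"
    using dim_eigenlattice[of 50 1729] dim_eigenlattice[of 65 1520] by simp_all
qed

text \<open>The lower bound holds because 25 divides 50. For the upper bound let 25 divide L x. If L
  y = 65 y, then 25 divides 65 times the pairing of y and x, so 5 divides the pairing; and the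
  pairing of L e with x is an entry of L x. Hence 1520 + 1 independent directions are orthogonal to
  the reduction.\<close>

lemma dim_div_lattice_2:
  assumes char: "CHAR('k::field) = 5"
  shows "vec.dim (of_int_vec ` div_lattice 2 :: ('k ^ 'v) set) = 1729"
proof (rule antisym)
  let ?g = "of_int_vec :: int ^ 'v \<Rightarrow> 'k ^ 'v"
  have "eigenlattice 50 \<subseteq> div_lattice 2"
    by (auto simp: eigenlattice_def div_lattice_def)
  then have "vec.dim (?g ` eigenlattice 50) \<le> vec.dim (?g ` div_lattice 2)"
    by (intro vec.dim_subset image_mono)
  then show "1729 \<le> vec.dim (?g ` div_lattice 2)"
    using dim_eigenlattice_char_5(1)[OF char] by simp
  have g_prod: "(\<Sum>i\<in>UNIV. ?g x $ i * ?g y $ i) = of_int (\<Sum>i\<in>UNIV. x $ i * y $ i)" for x y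
    by simp
  define e :: "int ^ 'v" where "e = axis undefined 1"
  \<comment> \<open>Pairing with z = (L - 65) e vanishes on the 65-eigenlattice. On L e it gives 50
    * 57 - 3249 = -399, which 5 does not divide, so L e stays outside the reduced eigenlattice's
    span.\<close>
  define z where "z = L *v e - 65 *s e"
  have e: "(\<Sum>i\<in>UNIV. e $ i * x $ i) = x $ undefined" for x :: "int ^ 'v"
    unfolding e_def by (rule sum_mult_axis)
  have zx: "(\<Sum>i\<in>UNIV. z $ i * x $ i) = (L *v x) $ undefined - 65 * x $ undefined" for x
    using L_adjoint[of e x] e[of x] e[of "L *v x"]
    by (simp add: z_def left_diff_distrib sum_subtractf mult.assoc flip: sum_distrib_left)
  have "?g (L *v e) \<notin> vec.span (?g ` eigenlattice 65)"
  proof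
    assume "?g (L *v e) \<in> vec.span (?g ` eigenlattice 65)"
    then have "(\<Sum>i\<in>UNIV. ?g z $ i * ?g (L *v e) $ i) = 0"
    proof (induction rule: vec.span_induct_alt)
      case (step c x y)
      then obtain x' where x': "x = ?g x'" "x' \<in> eigenlattice 65"
        by auto
      then have "(\<Sum>i\<in>UNIV. ?g z $ i * x $ i) = 0"
        unfolding x'(1) g_prod zx by (simp add: eigenlattice_def)
      then show ?case
        using step.IH by (simp add: distrib_left sum.distrib mult.left_commute flip: sum_distrib_left)
    qed simp
    then have "5 dvd (L *v (L *v e)) $ undefined - 65 * (L *v e) $ undefined"
      unfolding g_prod zx of_int_eq_0_iff_char_dvd by (simp add: char)
    moreover have "(L *v e) $ undefined = 57"
      by (simp add: e_def matrix_vector_mult_axis column_def diag)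
    moreover have "(L *v (L *v e)) $ undefined = 115 * 57 - 3250 + 1"
    proof -
      have "e $ undefined = 1" "(\<Sum>i\<in>UNIV. e $ i) = 1"
        unfolding e_def by (simp add: axis_def, rule sum_axis)
      then show ?thesis
        unfolding L_square by (simp add: \<open>(L *v e) $ undefined = 57\<close>)
    qed
    ultimately show False
      by simp
  qed
  then have "1521 \<le> vec.dim (insert (?g (L *v e)) (?g ` eigenlattice 65))"
    using dim_eigenlattice_char_5(2)[OF char] by (simp add: vec.dim_insert)
  moreover have "vec.dim (insert (?g (L *v e)) (?g ` eigenlattice 65)) + vec.dim (?g ` div_lattice 2) \<le> CARD('v)"
  proof (rule dim_orthogonal_le)
    fix s t assume s: "s \<in> insert (?g (L *v e)) (?g ` eigenlattice 65)" and "t \<in> ?g ` div_lattice 2"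
    then obtain x where x: "x \<in> div_lattice 2" "t = ?g x"
      by auto
    have Lx: "25 dvd (L *v x) $ i" for i
      using x by (simp add: div_lattice_def)
    show "(\<Sum>i\<in>UNIV. s $ i * t $ i) = 0"
    proof (cases "s = ?g (L *v e)")
      case True
      have "5 dvd (L *v x) $ undefined"
        by (rule dvd_trans[OF _ Lx]) simp
      then show ?thesis
        unfolding True x(2) g_prod L_adjoint e of_int_eq_0_iff_char_dvd by (simp add: char)
    next
      case False
      then obtain y where y: "L *v y = 65 *s y" "s = ?g y"
        using s by (auto simp: eigenlattice_def)
      have "25 dvd (\<Sum>i\<in>UNIV. y $ i * (L *v x) $ i)"
        using Lx by (intro dvd_sum) auto
      also have "\<dots> = 65 * (\<Sum>i\<in>UNIV. y $ i * x $ i)"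
        unfolding L_adjoint[symmetric] y by (simp add: sum_distrib_left mult.assoc)
      finally have "5 dvd (\<Sum>i\<in>UNIV. y $ i * x $ i)"
        by presburger
      then show ?thesis
        unfolding y x(2) g_prod of_int_eq_0_iff_char_dvd by (simp add: char)
    qed
  qed
  ultimately show "vec.dim (?g ` div_lattice 2) \<le> 1729"
    by (simp add: card_V)
qed

text \<open>Modulo 5 the square of L is J. Thus L maps the sum-zero vectors to a proper subspace of
  its range, and adding the image of one vector of sum 1 fills the range. That subspace is the span
  of the reduction of \<open>div_lattice 3\<close>.\<close>

lemma dim_div_lattice_3:
  assumes char: "CHAR('k::field) = 5"
  shows "rank (LR :: 'k ^ 'v ^ 'v) = Suc (vec.dim (of_int_vec ` div_lattice 3 :: ('k ^ 'v) set))"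
proof -
  let ?g = "of_int_vec :: int ^ 'v \<Rightarrow> 'k ^ 'v"
  let ?L = "LR :: 'k ^ 'v ^ 'v"
  let ?Y = "{y :: 'k ^ 'v. (\<Sum>i\<in>UNIV. y $ i) = 0}"
  define e :: "'k ^ 'v" where "e = axis undefined 1"
  have sum_e: "(\<Sum>i\<in>UNIV. e $ i) = 1"
    unfolding e_def by (rule sum_axis)
  have LL: "?L *v (?L *v x) = vec (\<Sum>i\<in>UNIV. x $ i)" for x
    unfolding LR_square by (simp add: numeral_eq_0_char_5[OF char])
  have sub1: "?g ` div_lattice 3 \<subseteq> (*v) ?L ` ?Y"
  proof clarify
    fix x assume x: "x \<in> div_lattice 3"
    define w :: "int ^ 'v" where "w = (\<chi> i. (L *v x) $ i div 125)"
    have Lx: "L *v x = 125 *s w"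
      using x by (simp add: div_lattice_def w_def vec_eq_iff)
    have w0: "(\<Sum>i\<in>UNIV. w $ i) = 0"
      using sum_L[of x] by (simp add: Lx flip: sum_distrib_left)
    have comp: "125 * (L *v w) $ i = 115 * 125 * w $ i - 3250 * x $ i + (\<Sum>i\<in>UNIV. x $ i)" for i
      using arg_cong[OF L_square[of x], of "\<lambda>y. y $ i"] by (simp add: Lx matrix_vector_mult_scale)
    \<comment> \<open>Dividing the square identity by 125 gives L w = 115 w - 26 x + s with a
      constant \<open>s\<close>. As 26 is 1 modulo 5, x is congruent to s - L w.\<close>
    define s where "s = (L *v w) $ undefined - 115 * w $ undefined + 26 * x $ undefined"
    have "(\<Sum>i\<in>UNIV. x $ i) = 125 * s"
      using comp[of undefined] by (simp add: s_def)
    then have mod5: "x $ i = s - (L *v w) $ i + 5 * (23 * w $ i - 5 * x $ i)" for i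
      using comp[of i] by simp
    have "of_int (x $ i) = (of_int (s - (L *v w) $ i) :: 'k)" for i
      using of_int_eq_0_iff_char_dvd[of "x $ i - (s - (L *v w) $ i)", where 'a = 'k] mod5[of i]
      unfolding of_int_diff[of "x $ i"] by (simp add: char del: of_int_diff) presburger
    then have "?g x = vec (of_int s) - ?L *v ?g w"
      by (simp add: vec_eq_iff flip: of_int_vec_mult)
    \<comment> \<open>The constant vector is also an image: modulo 5, applying L twice to
      \<open>e\<close> gives the all-ones vector. The resulting argument still has sum zero.\<close>
    also have "\<dots> = ?L *v (of_int s *s (?L *v e) - ?g w)"
      by (simp add: matrix_vector_mult_diff_distrib matrix_vector_mult_scale LL sum_e) (simp add: vec_eq_iff)
    finally have "?g x = ?L *v (of_int s *s (?L *v e) - ?g w)" .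
    moreover have "(\<Sum>i\<in>UNIV. (of_int s *s (?L *v e) - ?g w) $ i) = 0"
      using sum_LR[of e] w0 by (simp add: sum_subtractf flip: sum_distrib_left of_int_sum)
    ultimately show "?g x \<in> (*v) ?L ` ?Y"
      by blast
  qed
  have sub2: "(*v) ?L ` ?Y \<subseteq> vec.span (?g ` div_lattice 3)"
  proof clarify
    fix y :: "'k ^ 'v" assume y: "(\<Sum>i\<in>UNIV. y $ i) = 0"
    \<comment> \<open>These integral vectors have sum zero, and their reductions span the sum-zero
      vectors over the field.\<close>
    define u :: "'v \<Rightarrow> int ^ 'v" where "u i = axis i 1 - axis undefined 1" for i
    have u0: "(\<Sum>j\<in>UNIV. u i $ j) = 0" for i
      by (simp add: u_def sum_subtractf sum_axis)
    have "(\<Sum>i\<in>UNIV. y $ i *s ?g (u i)) $ j = y $ j" for j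
    proof -
      have "(\<Sum>i\<in>UNIV. y $ i *s ?g (u i)) $ j
          = (\<Sum>i\<in>UNIV. (if i = j then y $ i else 0) - y $ i * of_int (axis undefined 1 $ j))"
        by (simp add: u_def, intro sum.cong) (auto simp: axis_def algebra_simps)
      also have "\<dots> = y $ j"
        using y by (simp add: sum_subtractf flip: sum_distrib_right)
      finally show ?thesis .
    qed
    then have "y = (\<Sum>i\<in>UNIV. y $ i *s ?g (u i))"
      by (simp add: vec_eq_iff del: sum_component)
    then have "?L *v y = (\<Sum>i\<in>UNIV. y $ i *s (?L *v ?g (u i)))"
      by (metis (no_types, lifting) matrix_vector_mult_scale sum.cong vec.linear_sum matrix_vector_mul_linear_gen)
    also have "\<dots> = (\<Sum>i\<in>UNIV. y $ i *s ?g (L *v u i - 115 *s u i))"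
      by (simp add: of_int_vec_diff of_int_vec_scale of_int_vec_mult numeral_eq_0_char_5[OF char])
    also have "\<dots> \<in> vec.span (?g ` div_lattice 3)"
    proof (intro vec.span_sum vec.span_scale vec.span_base imageI)
      fix i
      \<comment> \<open>Subtracting 115 times \<open>u i\<close> leaves the reduction modulo 5 equal
        to that of L applied to \<open>u i\<close>, and makes the next image divisible by 3250,
        hence by 125.\<close>
      have "L *v (L *v u i - 115 *s u i) = - 3250 *s u i"
        unfolding matrix_vector_mult_diff_distrib matrix_vector_mult_scale L_square u0
        by (simp add: vec_eq_iff)
      then show "L *v u i - 115 *s u i \<in> div_lattice 3"
        by (simp add: div_lattice_def)
    qed
    finally show "?L *v y \<in> vec.span (?g ` div_lattice 3)" .
  qed
  have "vec.dim (?g ` div_lattice 3) = vec.dim ((*v) ?L ` ?Y)"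
    using sub1 sub2 by (intro antisym vec.dim_mono vec.dim_subset)
  \<comment> \<open>L vanishes on images of sum-zero vectors but sends L e to the all-ones
    vector.\<close>
  moreover have "?L *v e \<notin> vec.span ((*v) ?L ` ?Y)"
  proof
    assume "?L *v e \<in> vec.span ((*v) ?L ` ?Y)"
    then have "?L *v (?L *v e) = 0"
      by (induction rule: vec.span_induct_alt)
        (auto simp: matrix_vector_right_distrib matrix_vector_mult_scale LL vec_eq_iff)
    then show False
      by (simp add: LL sum_e vec_eq_iff)
  qed
  moreover have "vec.dim (range ((*v) ?L)) = vec.dim (insert (?L *v e) ((*v) ?L ` ?Y))"
  proof (intro antisym vec.dim_mono)
    show "range ((*v) ?L) \<subseteq> vec.span (insert (?L *v e) ((*v) ?L ` ?Y))"
    proof clarify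
      fix x :: "'k ^ 'v"
      let ?s = "\<Sum>i\<in>UNIV. x $ i"
      have "x - ?s *s e \<in> ?Y"
        using sum_e by (simp add: sum_subtractf flip: sum_distrib_left)
      then have "?L *v (x - ?s *s e) + ?s *s (?L *v e) \<in> vec.span (insert (?L *v e) ((*v) ?L ` ?Y))"
        by (intro vec.span_add vec.span_scale vec.span_base) auto
      then show "?L *v x \<in> vec.span (insert (?L *v e) ((*v) ?L ` ?Y))"
        by (simp add: matrix_vector_mult_diff_distrib matrix_vector_mult_scale)
    qed
    show "insert (?L *v e) ((*v) ?L ` ?Y) \<subseteq> vec.span (range ((*v) ?L))"
      by (auto intro: vec.span_base)
  qed
  ultimately show ?thesis
    by (simp add: rank_symmetric[OF transpose_LR] vec.dim_insert)
qed

section \<open>The torsion of the cokernel as classes of sum-zero vectors\<close>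

definition cls :: "int ^ 'v \<Rightarrow> (int ^ 'v) set" where
  "cls x = range ((*v) L) #>\<^bsub>int_vec_group\<^esub> x"

sublocale int_vec: comm_group "int_vec_group :: (int ^ 'v) monoid"
  by (rule comm_group_int_vec_group)

lemma subgroup_range_L: "subgroup (range ((*v) L)) int_vec_group"
proof (rule int_vec.subgroupI)
  show "x \<otimes>\<^bsub>int_vec_group\<^esub> y \<in> range ((*v) L)" if "x \<in> range ((*v) L)" "y \<in> range ((*v) L)" for x y
    using add_subgroup_add[OF add_subgroup_range_L that] by simp
  show "inv\<^bsub>int_vec_group\<^esub> x \<in> range ((*v) L)" if "x \<in> range ((*v) L)" for x
    using add_subgroup_scale[OF add_subgroup_range_L that, of "- 1"] by (simp only: inv_int_vec_group vector_sneg_minus1)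
qed auto

sublocale int_vec: normal "range ((*v) L)" int_vec_group
  by (rule int_vec.subgroup_imp_normal[OF subgroup_range_L])

lemma cls_eq_iff: "cls x = cls y \<longleftrightarrow> x - y \<in> range ((*v) L)"
proof -
  have mem: "z \<in> cls x \<longleftrightarrow> z - x \<in> range ((*v) L)" for z x
    by (auto simp: cls_def r_coset_def algebra_simps image_iff)
  show ?thesis
  proof
    assume "cls x = cls y"
    then have "x \<in> cls y"
      using mem[of x x] add_subgroup_zero[OF add_subgroup_range_L] by simp
    then show "x - y \<in> range ((*v) L)"
      by (simp add: mem)
  next
    assume *: "x - y \<in> range ((*v) L)"
    have "z - x \<in> range ((*v) L) \<longleftrightarrow> z - y \<in> range ((*v) L)" for z
      using add_subgroup_add[OF add_subgroup_range_L _ *, of "z - x"]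
        add_subgroup_diff[OF add_subgroup_range_L _ *, of "z - y"] by auto
    then show "cls x = cls y"
      by (simp add: set_eq_iff mem)
  qed
qed

lemma comm_group_coker: "comm_group (coker L)"
  unfolding coker_def by (rule int_vec.abelian_FactGroup[OF subgroup_range_L])

lemma carrier_coker: "carrier (coker L) = range cls"
  by (auto simp: coker_def carrier_FactGroup cls_def)

lemma one_coker: "\<one>\<^bsub>coker L\<^esub> = cls 0"
  using int_vec.coset_mult_one[of "range ((*v) L)"] by (simp add: coker_def cls_def)

lemma pow_coker: "cls x [^]\<^bsub>coker L\<^esub> (n::nat) = cls (int n *s x)"
  unfolding coker_def cls_def by (simp add: int_vec.FactGroup_pow pow_int_vec_group)

definition sum_zero :: "(int ^ 'v) set" where
  "sum_zero = {x. (\<Sum>i\<in>UNIV. x $ i) = 0}"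

text \<open>On sum-zero vectors J vanishes, so L (115 - L) = 3250; this is the witness.\<close>

lemma scale_3250_in_range: "x \<in> sum_zero \<Longrightarrow> 3250 *s x \<in> range ((*v) L)"
  by (rule range_eqI[of _ _ "115 *s x - L *v x"])
    (simp add: sum_zero_def matrix_vector_mult_diff_distrib matrix_vector_mult_scale L_square)

lemma range_L_subset: "range ((*v) L) \<subseteq> sum_zero"
  by (auto simp: sum_zero_def sum_L)

text \<open>The range of L has sum zero, so a torsion class comes from a vector with a positive
  multiple of sum zero, which has sum zero itself. Conversely 3250 annihilates all such
  classes.\<close>

lemma torsion_subgroup_coker:
  "torsion_subgroup (coker L) = (coker L)\<lparr>carrier := cls ` sum_zero\<rparr>"
proof -
  have "{x \<in> carrier (coker L). \<exists>n::nat. n > 0 \<and> x [^]\<^bsub>coker L\<^esub> n = \<one>\<^bsub>coker L\<^esub>} = cls ` sum_zero"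
  proof (intro equalityI subsetI)
    fix X assume "X \<in> {x \<in> carrier (coker L). \<exists>n::nat. n > 0 \<and> x [^]\<^bsub>coker L\<^esub> n = \<one>\<^bsub>coker L\<^esub>}"
    then obtain x and n :: nat where x: "X = cls x" and n: "n > 0" and "cls (int n *s x) = cls 0"
      by (auto simp: carrier_coker one_coker pow_coker)
    then have "int n *s x \<in> sum_zero"
      using range_L_subset by (auto simp: cls_eq_iff)
    then have "x \<in> sum_zero"
      using n by (simp add: sum_zero_def flip: sum_distrib_left)
    then show "X \<in> cls ` sum_zero"
      by (simp add: x)
  next
    fix X assume "X \<in> cls ` sum_zero"
    then obtain x where x: "X = cls x" "x \<in> sum_zero"
      by auto
    then have "X [^]\<^bsub>coker L\<^esub> (3250::nat) = \<one>\<^bsub>coker L\<^esub>"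
      using scale_3250_in_range by (simp add: pow_coker one_coker cls_eq_iff)
    then show "X \<in> {x \<in> carrier (coker L). \<exists>n::nat. n > 0 \<and> x [^]\<^bsub>coker L\<^esub> n = \<one>\<^bsub>coker L\<^esub>}"
      by (auto simp: carrier_coker x intro!: exI[of _ "3250::nat"])
  qed
  then show ?thesis
    by (simp add: torsion_subgroup_def)
qed

abbreviation K :: "(int ^ 'v) set monoid" where
  "K \<equiv> torsion_subgroup (coker L)"

lemma carrier_K: "carrier K = cls ` sum_zero"
  by (simp add: torsion_subgroup_coker)

lemma one_K: "\<one>\<^bsub>K\<^esub> = cls 0"
  by (simp add: torsion_subgroup_coker one_coker)

lemma pow_K: "cls x [^]\<^bsub>K\<^esub> (n::nat) = cls (int n *s x)"
  using pow_coker[of x n] by (simp add: torsion_subgroup_coker nat_pow_def)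

lemma comm_group_K: "comm_group K"
proof -
  interpret C: comm_group "coker L"
    by (rule comm_group_coker)
  have cls_add: "cls x \<otimes>\<^bsub>coker L\<^esub> cls y = cls (x + y)" for x y
    using int_vec.rcos_sum[of x y] by (simp add: coker_def cls_def)
  have "subgroup (cls ` sum_zero) (coker L)"
  proof (rule C.subgroupI)
    show "cls ` sum_zero \<noteq> {}"
      by (auto simp: sum_zero_def intro: exI[of _ 0])
    show "X \<otimes>\<^bsub>coker L\<^esub> Y \<in> cls ` sum_zero" if "X \<in> cls ` sum_zero" "Y \<in> cls ` sum_zero" for X Y
      using that by (auto simp: cls_add sum_zero_def sum.distrib)
    show "inv\<^bsub>coker L\<^esub> X \<in> cls ` sum_zero" if "X \<in> cls ` sum_zero" for X
    proof -
      obtain x where x: "X = cls x" "x \<in> sum_zero"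
        using \<open>X \<in> cls ` sum_zero\<close> by auto
      have "inv\<^bsub>coker L\<^esub> X = cls (- x)"
        by (rule C.inv_equality) (simp_all add: x cls_add one_coker carrier_coker)
      moreover have "- x \<in> sum_zero"
        using x by (simp add: sum_zero_def sum_negf)
      ultimately show ?thesis
        by simp
    qed
  qed (auto simp: carrier_coker)
  then show ?thesis
    unfolding torsion_subgroup_coker by (rule C.comm_group_subgroup)
qed

text \<open>Residues modulo 3250 determine a class: two congruent sum-zero vectors differ by 3250
  times a sum-zero vector, which lies in the range of L.\<close>

lemma finite_K: "finite (carrier K)"
proof -
  let ?m = "\<lambda>x::int ^ 'v. \<lambda>i. x $ i mod 3250"
  have eq: "cls x = cls y" if xy: "x \<in> sum_zero" "y \<in> sum_zero" "?m x = ?m y" for x y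
  proof -
    have "3250 dvd x $ i - y $ i" for i
      using fun_cong[OF xy(3), of i] by (simp add: mod_eq_dvd_iff)
    then have eq: "x - y = 3250 *s (\<chi> i. (x $ i - y $ i) div 3250)"
      by (simp add: vec_eq_iff)
    have "(\<Sum>i\<in>UNIV. (x - y) $ i) = 0"
      using xy by (simp add: sum_zero_def sum_subtractf)
    then have "(\<chi> i. (x $ i - y $ i) div 3250) \<in> sum_zero"
      by (subst (asm) eq) (simp add: sum_zero_def flip: sum_distrib_left)
    then show ?thesis
      unfolding cls_eq_iff eq by (rule scale_3250_in_range)
  qed
  have "cls ` sum_zero \<subseteq> (\<lambda>f. cls (inv_into sum_zero ?m f)) ` ?m ` sum_zero"
  proof clarify
    fix x assume x: "x \<in> sum_zero"
    have "cls x = cls (inv_into sum_zero ?m (?m x))"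
      using x by (intro eq inv_into_into imageI f_inv_into_f[symmetric])
    then show "cls x \<in> (\<lambda>f. cls (inv_into sum_zero ?m f)) ` ?m ` sum_zero"
      using x by blast
  qed
  moreover have "finite (?m ` sum_zero)"
    by (rule finite_subset[of _ "UNIV \<rightarrow>\<^sub>E {0..<3250}"]) (auto simp: finite_PiE)
  ultimately show ?thesis
    unfolding carrier_K by (blast intro: finite_subset)
qed

lemma pow_3250_K:
  assumes "X \<in> carrier K"
  shows "X [^]\<^bsub>K\<^esub> (5 ^ 3 * 26 :: nat) = \<one>\<^bsub>K\<^esub>"
proof -
  obtain x where "X = cls x" "x \<in> sum_zero"
    using assms by (auto simp: carrier_K)
  then show ?thesis
    using scale_3250_in_range[of x] by (simp add: pow_K one_K cls_eq_iff)
qed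

text \<open>The map \<open>x \<mapsto> L x / 5\<close> identifies the layer with \<open>div_lattice (Suc j)\<close> modulo \<open>5\<close> and constant vectors.\<close>

lemma card_torsion_layer_K:
  assumes char: "CHAR('k::field) = 5"
  shows "5 ^ vec.dim (of_int_vec ` div_lattice (Suc j) :: ('k ^ 'v) set) = card (torsion_layer 5 j K) * 5"
proof -
  let ?g = "of_int_vec :: int ^ 'v \<Rightarrow> 'k ^ 'v"
  let ?M = "div_lattice (Suc j)"
  define q where "q x = (\<chi> i. (L *v x) $ i div 5)" for x
  \<comment> \<open>\<open>W\<close> is the kernel of the map \<open>x\<close> to
    \<open>cls (q x)\<close>: the class is trivial when L x = 5 L z for some z, that is, when x - 5
    z is constant.\<close>
  define W where "W = {x \<in> ?M. \<exists>c z. x = vec c + 5 *s z}"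
  have p5: "prime (5::nat)"
    by simp
  have q: "5 *s q x = L *v x" if "x \<in> ?M" for x
  proof -
    have "5 dvd (L *v x) $ i" for i
      using that by (auto simp: div_lattice_def intro: dvd_mult_left)
    then show ?thesis
      by (simp add: q_def vec_eq_iff)
  qed
  have "card (?g ` ?M) = card ((\<lambda>x. cls (q x)) ` ?M) * card (?g ` W)"
  proof (rule card_image_add_subgroup[OF add_subgroup_div_lattice])
    show "add_subgroup W"
      unfolding add_subgroup_def
    proof (intro conjI ballI)
      show "0 \<in> W"
        by (auto simp: W_def add_subgroup_zero[OF add_subgroup_div_lattice] intro!: exI[of _ 0])
      show "x - y \<in> W" if xy: "x \<in> W" "y \<in> W" for x y
      proof -
        obtain c z d w where "x = vec c + 5 *s z" "y = vec d + 5 *s w"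
          using xy by (auto simp: W_def)
        then have "x - y = vec (c - d) + 5 *s (z - w)"
          by (simp add: vec_eq_iff)
        then show ?thesis
          using xy add_subgroup_diff[OF add_subgroup_div_lattice, of x "Suc j" y]
          unfolding W_def by blast
      qed
    qed
    show "W \<subseteq> ?M"
      by (auto simp: W_def)
    show "{x \<in> ?M. \<forall>i. 5 dvd x $ i} \<subseteq> W"
    proof clarify
      fix x assume x: "x \<in> ?M" "\<forall>i. 5 dvd x $ i"
      then have "x = vec 0 + 5 *s (\<chi> i. x $ i div 5)"
        by (simp add: vec_eq_iff)
      then show "x \<in> W"
        using x unfolding W_def by blast
    qed
    show "?g x = ?g y \<longleftrightarrow> x - y \<in> {x \<in> ?M. \<forall>i. 5 dvd x $ i}" if "x \<in> ?M" "y \<in> ?M" for x y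
      using add_subgroup_diff[OF add_subgroup_div_lattice that] by (simp add: of_int_vec_eq_iff char)
    show "finite (?g ` ?M)"
      by (rule finite_subset[OF image_mono[OF subset_UNIV] finite_range_of_int_vec]) (simp add: char)
    show "cls (q x) = cls (q y) \<longleftrightarrow> x - y \<in> W" if xy: "x \<in> ?M" "y \<in> ?M" for x y
    proof -
      have eq5: "5 *s u = 5 *s v \<longleftrightarrow> u = v" for u v :: "int ^ 'v"
        by (simp add: vec_eq_iff)
      have "cls (q x) = cls (q y) \<longleftrightarrow> (\<exists>z. q x - q y = L *v z)"
        by (auto simp: cls_eq_iff)
      also have "\<dots> \<longleftrightarrow> (\<exists>z. 5 *s (q x - q y) = 5 *s (L *v z))"
        unfolding eq5 ..
      also have "\<dots> \<longleftrightarrow> (\<exists>z. L *v (x - y - 5 *s z) = 0)"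
        by (simp add: vector_ssub_ldistrib q xy matrix_vector_mult_diff_distrib matrix_vector_mult_scale)
      also have "\<dots> \<longleftrightarrow> (\<exists>c z. x - y = vec c + 5 *s z)"
        unfolding L_eq_0_iff diff_eq_eq by blast
      also have "\<dots> \<longleftrightarrow> x - y \<in> W"
        using add_subgroup_diff[OF add_subgroup_div_lattice xy] by (simp add: W_def)
      finally show ?thesis .
    qed
  qed
  moreover have "(\<lambda>x. cls (q x)) ` ?M = torsion_layer 5 j K"
  proof (intro equalityI subsetI)
    fix X assume "X \<in> (\<lambda>x. cls (q x)) ` ?M"
    then obtain x where x: "x \<in> ?M" "X = cls (q x)"
      by auto
    \<comment> \<open>The class of \<open>w\<close> is killed by \<open>5 ^ Suc j\<close>, and
      \<open>q x\<close> is \<open>5 ^ j\<close> times \<open>w\<close>, so it is an element of the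
      layer.\<close>
    define w where "w = (\<chi> i. (L *v x) $ i div 5 ^ Suc j)"
    have Lx: "L *v x = 5 ^ Suc j *s w"
      using x by (simp add: div_lattice_def w_def vec_eq_iff)
    then have "q x = 5 ^ j *s w"
      by (simp add: q_def vec_eq_iff)
    moreover have "w \<in> sum_zero"
      using sum_L[of x] unfolding Lx by (simp add: sum_zero_def flip: sum_distrib_left)
    moreover have "cls (5 ^ Suc j *s w) = cls 0"
      unfolding cls_eq_iff Lx[symmetric] by simp
    ultimately show "X \<in> torsion_layer 5 j K"
      unfolding torsion_layer_def x(2)
      by (intro image_eqI[of _ _ "cls w"]) (simp_all add: pow_K one_K carrier_K)
  next
    fix X assume "X \<in> torsion_layer 5 j K"
    then obtain w where w: "X = cls (5 ^ j *s w)" "cls (5 ^ Suc j *s w) = cls 0"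
      by (auto simp: torsion_layer_def carrier_K pow_K one_K)
    then obtain x where x: "5 ^ Suc j *s w = L *v x"
      by (auto simp: cls_eq_iff)
    then have "x \<in> ?M"
      unfolding div_lattice_def mem_Collect_eq x[symmetric] by simp
    moreover have "q x = 5 ^ j *s w"
      by (simp add: q_def x[symmetric] vec_eq_iff)
    ultimately show "X \<in> (\<lambda>x. cls (q x)) ` ?M"
      using w(1) by (intro image_eqI) simp_all
  qed
  \<comment> \<open>Modulo 5 only the constant part of an element of \<open>W\<close> survives, so
    the reduction is the line of constants over the prime field. This is the extra factor 5.\<close>
  moreover have "card (?g ` W) = 5"
  proof -
    have "?g (vec c + 5 *s z) = ?g (vec c)" for c z
      by (simp add: of_int_vec_eq_iff char)
    moreover have "vec c \<in> W" for c
    proof -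
      have "vec c \<in> ?M" "vec c = vec c + 5 *s (0 :: int ^ 'v)"
        by (simp_all add: div_lattice_def L_vec)
      then show ?thesis
        unfolding W_def by blast
    qed
    ultimately have gW: "?g ` W = ?g ` range vec"
      by (force simp: W_def)
    have card: "card (?g ` range vec) = 5 ^ vec.dim (?g ` range vec)"
    proof (rule card_of_int_vec_image[OF char p5])
      show "add_subgroup (range (vec :: int \<Rightarrow> int ^ 'v))"
        unfolding add_subgroup_def by (auto intro: range_eqI[of _ _ 0]) (metis rangeI vec_sub)
    qed
    have dim: "vec.dim (?g ` range vec) = vec.dim {vec 1 :: 'k ^ 'v}"
    proof (intro antisym vec.dim_mono)
      show "?g ` range vec \<subseteq> vec.span {vec 1}"
        by (auto simp: vec.span_singleton vec_eq_iff)
      show "{vec 1} \<subseteq> vec.span (?g ` range vec)"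
        by (auto intro!: vec.span_base image_eqI[of _ _ "vec 1"] simp: vec_eq_iff)
    qed
    show ?thesis
      unfolding gW card dim by (simp add: vec_eq_iff)
  qed
  ultimately show ?thesis
    using card_of_int_vec_image[OF char p5 add_subgroup_div_lattice, of "Suc j"] by simp
qed

text \<open>The 125-torsion \<open>S\<close> decomposes with unknown exponents \<open>a\<close>,
  \<open>b\<close>, \<open>c\<close>; the three lattice dimensions give three linear equations that
  determine them. Since 26 is coprime to 5, \<open>S\<close> is the Sylow subgroup.\<close>

lemma syl_5_torsion_coker:
  assumes char: "CHAR('k::field) = 5" and e0: "e0 = rank (LR :: 'k ^ 'v ^ 'v)"
  shows "2 \<le> e0 \<and> e0 \<le> 1521 \<and> syl 5 K \<cong>
    cyclic_power 5 (1521 - e0) \<times>\<times> cyclic_power (5\<^sup>2) (1730 - e0) \<times>\<times> cyclic_power (5^3) (e0 - 2)"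
proof -
  interpret K: comm_group K
    by (rule comm_group_K)
  define T where "T = {X \<in> carrier K. X [^]\<^bsub>K\<^esub> (5 ^ 3 :: nat) = \<one>\<^bsub>K\<^esub>}"
  define S where "S = K\<lparr>carrier := T\<rparr>"
  have p5: "prime (5::nat)"
    by simp
  have S: "comm_group S"
    unfolding S_def T_def by (rule K.comm_group_subgroup[OF K.subgroup_pow_eq_one])
  have powS: "X [^]\<^bsub>S\<^esub> n = X [^]\<^bsub>K\<^esub> n" for X and n :: nat
    by (simp add: S_def flip: K.nat_pow_consistent)
  have oneS: "\<one>\<^bsub>S\<^esub> = \<one>\<^bsub>K\<^esub>"
    by (simp add: S_def)
  have finS: "finite (carrier S)"
    using finite_K by (simp add: S_def T_def)
  have "X [^]\<^bsub>S\<^esub> (5 ^ 3 :: nat) = \<one>\<^bsub>S\<^esub>" if "X \<in> carrier S" for X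
    using that unfolding powS oneS by (simp add: S_def T_def)
  then obtain a b c where iso: "S \<cong> cyclic_power 5 a \<times>\<times> cyclic_power (5\<^sup>2) b \<times>\<times> cyclic_power (5 ^ 3) c"
    using finite_abelian_exponent_cube_decomposition[OF S finS p5] by blast
  have "group S"
    using S by (rule comm_group.axioms(2))
  note cards = card_torsion_layer_cube_decomposition[OF this iso]
  \<comment> \<open>For \<open>j \<le> 2\<close> the elements killed by \<open>5 ^ Suc j\<close> are
    125-torsion, so passing from \<open>K\<close> to \<open>S\<close> loses nothing.\<close>
  have layer: "torsion_layer 5 j S = torsion_layer 5 j K" if "j \<le> 2" for j
  proof -
    have "X \<in> T" if X: "X \<in> carrier K" "X [^]\<^bsub>K\<^esub> (5 ^ Suc j :: nat) = \<one>\<^bsub>K\<^esub>" for X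
    proof -
      have "(5::nat) ^ 3 = 5 ^ Suc j * 5 ^ (2 - j)"
        using \<open>j \<le> 2\<close> by (simp flip: power_add power_Suc)
      then have "X [^]\<^bsub>K\<^esub> (5 ^ 3 :: nat) = (X [^]\<^bsub>K\<^esub> (5 ^ Suc j :: nat)) [^]\<^bsub>K\<^esub> (5 ^ (2 - j) :: nat)"
        using X(1) by (simp only: K.nat_pow_pow)
      then show ?thesis
        using X by (simp add: T_def)
    qed
    then have "{y \<in> carrier S. y [^]\<^bsub>K\<^esub> (5 ^ Suc j :: nat) = \<one>\<^bsub>K\<^esub>} =
        {y \<in> carrier K. y [^]\<^bsub>K\<^esub> (5 ^ Suc j :: nat) = \<one>\<^bsub>K\<^esub>}"
      by (auto simp: S_def T_def simp del: power_Suc)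
    then show ?thesis
      by (simp only: torsion_layer_def powS oneS)
  qed
  \<comment> \<open>The successor here and below comes from the factor 5 of constant vectors in
    \<open>card_torsion_layer_K\<close>.\<close>
  have "(5::nat) ^ vec.dim (of_int_vec ` div_lattice 1 :: ('k ^ 'v) set) = 5 ^ Suc (a + b + c)"
    using card_torsion_layer_K[OF char, of 0] cards(1) layer[of 0] by simp
  then have d1: "vec.dim (of_int_vec ` div_lattice 1 :: ('k ^ 'v) set) = Suc (a + b + c)"
    by (subst (asm) power_inject_exp) simp_all
  have "(5::nat) ^ vec.dim (of_int_vec ` div_lattice 2 :: ('k ^ 'v) set) = 5 ^ Suc (b + c)"
    using card_torsion_layer_K[OF char, of 1] cards(2) layer[of 1] by (simp add: numeral_2_eq_2)
  then have d2: "vec.dim (of_int_vec ` div_lattice 2 :: ('k ^ 'v) set) = Suc (b + c)"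
    by (subst (asm) power_inject_exp) simp_all
  have "(5::nat) ^ vec.dim (of_int_vec ` div_lattice 3 :: ('k ^ 'v) set) = 5 ^ Suc c"
    using card_torsion_layer_K[OF char, of 2] cards(3) layer[of 2] by (simp add: numeral_3_eq_3 numeral_2_eq_2)
  then have d3: "vec.dim (of_int_vec ` div_lattice 3 :: ('k ^ 'v) set) = Suc c"
    by (subst (asm) power_inject_exp) simp_all
  have "e0 + Suc (a + b + c) = 3250" "b + c = 1728" "e0 = Suc (Suc c)"
    using dim_div_lattice_1[OF char] dim_div_lattice_2[OF char] dim_div_lattice_3[OF char]
    unfolding d1 d2 d3 e0 by simp_all
  \<comment> \<open>As \<open>a\<close> and \<open>c\<close> are natural numbers, the equations also
    give the bounds on \<open>e0\<close>, under which none of the subtractions is truncated.\<close>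
  then have abc: "a = 1521 - e0" "b = 1730 - e0" "c = e0 - 2" "2 \<le> e0" "e0 \<le> 1521"
    by auto
  have "syl 5 K = S"
    unfolding S_def T_def
  proof (rule K.syl_eq_pow_eq_one[OF finite_K p5])
    show "coprime (5::nat) 26"
      using prime_imp_coprime[OF p5, of 26] by simp
    show "card {X \<in> carrier K. X [^]\<^bsub>K\<^esub> (5 ^ 3 :: nat) = \<one>\<^bsub>K\<^esub>} = 5 ^ (a + 2 * b + 3 * c)"
      using cards(4) by (simp add: S_def T_def)
  qed (rule pow_3250_K)
  then show ?thesis
    using iso abc by simp
qed

end

section \<open>From Moore graphs to the matrix identities\<close>

lemma girth_le_cycle: "is_cycle adj xs \<Longrightarrow> girth adj \<le> enat (length xs)"
  unfolding girth_def by (rule Inf_lower) blast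

text \<open>Girth 5 excludes triangles and quadrilaterals, so adjacent vertices share no neighbour
  and distinct ones at most one. Diameter 2 supplies a common neighbour for distinct nonadjacent
  vertices.\<close>

lemma moore_graph_diameter_two_common_neighbours:
  fixes adj :: "'v::finite \<Rightarrow> 'v \<Rightarrow> bool"
  assumes moore: "moore_graph 2 k adj"
  shows "card {z. adj x z \<and> adj z y} = (if x = y then k else if adj x y then 0 else 1)"
proof -
  have sym: "adj u v \<Longrightarrow> adj v u" and irrefl: "\<not> adj u u" and deg: "card {w. adj u w} = k"
    and diam: "graph_diameter adj = enat 2" and girth: "girth adj = enat 5" for u v
    using moore
    by (auto simp: moore_graph_def simple_graph_def regular_graph_def graph_degree_def
        dest: sympD irreflpD)
  have no3: False if "adj a b" "adj b c" "adj c a" for a b c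
  proof -
    have "is_cycle adj [a, b, c]"
      using that irrefl by (auto simp: is_cycle_def)
    then show False
      using girth_le_cycle[of adj "[a, b, c]"] by (simp add: girth)
  qed
  have no4: "a = b" if "adj x a" "adj a y" "adj x b" "adj b y" "x \<noteq> y" for a b x y
  proof (rule ccontr)
    assume "a \<noteq> b"
    then have "is_cycle adj [x, a, y, b]"
      using that irrefl sym by (auto simp: is_cycle_def)
    then show False
      using girth_le_cycle[of adj "[x, a, y, b]"] by (simp add: girth)
  qed
  have near: "\<exists>z. adj x z \<and> adj z y" if "x \<noteq> y" "\<not> adj x y" for x y
  proof -
    have "graph_dist adj x y \<le> enat 2"
      unfolding diam[symmetric] graph_diameter_def by (rule Sup_upper) blast
    \<comment> \<open>The strict bound lets the infimum be unfolded into an actual walk of length at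
      most 2.\<close>
    then have "graph_dist adj x y < enat 3"
      by (rule order.strict_trans1) simp
    then obtain n where n: "n < 3" "(adj ^^ n) x y"
      unfolding graph_dist_def Inf_less_iff by auto
    then consider "n = 0" | "n = 1" | "n = 2"
      by linarith
    then show ?thesis
      using n(2) that by cases (auto simp: numeral_2_eq_2 relcompp_apply)
  qed
  show ?thesis
  proof (cases "x = y")
    case True
    have "{z. adj x z \<and> adj z x} = {z. adj x z}"
      using sym by auto
    then show ?thesis
      using True deg by simp
  next
    case False
    show ?thesis
    proof (cases "adj x y")
      case True
      then have "{z. adj x z \<and> adj z y} = {}"
        using no3 sym by blast
      then show ?thesis
        using True False by simp
    next
      case adj: False
      then obtain z where "adj x z" "adj z y"
        using near False by blast
      then have "{z. adj x z \<and> adj z y} = {z}"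
        using no4 False by blast
      then show ?thesis
        using False adj by simp
    qed
  qed
qed

text \<open>Common neighbours give A^2 = 56 I - A + J for the adjacency matrix A; substituting A =
  57 I - L yields \<open>square\<close>.\<close>

lemma moore_laplacian_laplacian:
  fixes adj :: "'v::finite \<Rightarrow> 'v \<Rightarrow> bool"
  assumes moore: "moore_graph 2 57 adj"
  shows "moore_laplacian (laplacian adj)"
proof -
  define A where "A i j = (if adj i j then 1 else 0 :: int)" for i j
  have sym: "adj u v \<longleftrightarrow> adj v u" and irrefl: "\<not> adj u u" and deg: "card {w. adj u w} = 57" for u v
    using moore
    by (auto simp: moore_graph_def simple_graph_def regular_graph_def graph_degree_def
        dest: sympD irreflpD)
  have L: "laplacian adj $ i $ j = 57 * (if i = j then 1 else 0) - A i j" for i j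
    by (simp add: laplacian_def degree_matrix_def adjacency_matrix_def graph_degree_def deg A_def)
  have rowA: "(\<Sum>j\<in>UNIV. A i j) = 57" for i
    using deg[of i] by (simp add: A_def sum.If_cases)
  have AA: "(\<Sum>k\<in>UNIV. A i k * A k j) = (if i = j then 57 else if adj i j then 0 else 1)" for i j
  proof -
    have "(\<Sum>k\<in>UNIV. A i k * A k j) = (\<Sum>k\<in>UNIV. if adj i k \<and> adj k j then 1 else 0)"
      by (rule sum.cong) (auto simp: A_def)
    also have "\<dots> = int (card {k. adj i k \<and> adj k j})"
      by (simp add: sum.If_cases)
    finally show ?thesis
      by (simp add: moore_graph_diameter_two_common_neighbours[OF moore])
  qed
  show ?thesis
  proof
    fix i j :: 'v
    show "laplacian adj $ i $ j = laplacian adj $ j $ i"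
      using sym[of i j] by (simp add: L A_def)
    show "(\<Sum>j\<in>UNIV. laplacian adj $ i $ j) = 0"
      by (simp add: L sum_subtractf rowA flip: sum_distrib_left)
    show "laplacian adj $ i $ i = 57"
      by (simp add: L A_def irrefl)
    \<comment> \<open>The product is expanded so that the diagonal contributions sit at
      \<open>k = i\<close> and \<open>k = j\<close>.\<close>
    have "(\<Sum>k\<in>UNIV. laplacian adj $ i $ k * laplacian adj $ k $ j) =
      (\<Sum>k\<in>UNIV. (if k = i then 3249 * (if i = j then 1 else 0) - 57 * A i j else 0)
        - (if k = j then 57 * A i j else 0) + A i k * A k j)"
      by (rule sum.cong) (auto simp: L algebra_simps)
    also have "\<dots> = 3249 * (if i = j then 1 else 0) - 114 * A i j + (\<Sum>k\<in>UNIV. A i k * A k j)"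
      by (simp add: sum.distrib sum_subtractf)
    also have "\<dots> = 115 * laplacian adj $ i $ j - (if i = j then 3250 else 0) + 1"
      unfolding AA by (auto simp: L A_def irrefl)
    finally show "(\<Sum>k\<in>UNIV. laplacian adj $ i $ k * laplacian adj $ k $ j) =
      115 * laplacian adj $ i $ j - (if i = j then 3250 else 0) + 1" .
  next
    fix i :: 'v
    \<comment> \<open>Walks of length two from \<open>i\<close> are counted by middle vertex and by
      endpoint, which gives the number of vertices.\<close>
    have "57 * 57 = (\<Sum>k\<in>UNIV. A i k * (\<Sum>j\<in>UNIV. A k j))"
      by (simp add: rowA flip: sum_distrib_right)
    also have "\<dots> = (\<Sum>j\<in>UNIV. \<Sum>k\<in>UNIV. A i k * A k j)"
      by (subst sum.swap) (simp add: sum_distrib_left)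
    also have "\<dots> = (\<Sum>j\<in>UNIV. 56 * (if j = i then 1 else 0) - A i j + 1)"
      unfolding AA by (rule sum.cong) (auto simp: A_def irrefl)
    also have "\<dots> = 56 - 57 + int CARD('v)"
      by (simp add: sum.distrib sum_subtractf rowA flip: sum_distrib_left)
    finally show "CARD('v) = 3250"
      by simp
  qed
qed

theorem theoremB:
  fixes adj :: "'v::finite \<Rightarrow> 'v \<Rightarrow> bool"
    and e0 :: nat
  assumes "moore_graph 2 57 adj"
    and "CHAR('k::field) = 5"
    and "e0 = rank (map_matrix of_int (laplacian adj) :: 'k ^ 'v ^ 'v)"
  shows
    "(3 \<le> e0 \<and> e0 \<le> 1520 \<and>
        syl 5 (critical_group adj) \<cong>
          cyclic_power 5 (1520 - e0) \<times>\<times> cyclic_power (5\<^sup>2) (1732 - e0) \<times>\<times> cyclic_power (5^3) (e0 - 3)) \<or>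
     (2 \<le> e0 \<and> e0 \<le> 1521 \<and>
        syl 5 (critical_group adj) \<cong>
          cyclic_power 5 (1521 - e0) \<times>\<times> cyclic_power (5\<^sup>2) (1730 - e0) \<times>\<times> cyclic_power (5^3) (e0 - 2))"
proof -
  interpret moore_laplacian "laplacian adj"
    by (rule moore_laplacian_laplacian[OF assms(1)])
  show ?thesis
    unfolding critical_group_def by (rule disjI2) (rule syl_5_torsion_coker[OF assms(2,3)])
qed

end
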